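(* Let $d\ge 1$ be an integer, let $\mathcal D_\rho>0$, $\mathcal D_{m_1},\dots,\mathcal D_{m_d}>0$ and $\zeta>0$ be real numbers, and let $M$ be a concave mobility of one of the following two forms: (I) $M(\rho)=(\rho-\alpha)^{\xi}(\beta-\rho)^{\xi}$ with $\alpha<\beta$, $\xi\in(0,1]$, for $\alpha\le\rho\le\beta$; (II) $M(\rho)=\rho^{\xi}$ with $\xi\in(0,1]$, for $\rho\ge 0$. Let $\varphi$ be the action function associated with $M$, and let $L$ be the scalar function associated with the data (both defined in the context). Then for an input $(\hat\rho,\hat{\boldsymbol m})\in\mathbb R\times\mathbb R^d$ the following hold. (A) The problem $$\min_{\rho,\boldsymbol m}\ \tfrac12\mathcal D_\rho(\rho-\hat\rho)^2+\tfrac12\sum_{j=1}^d\mathcal D_{m_j}(m_j-\hat m_j)^2+\tfrac{\zeta}{2}\varphi(\rho,\boldsymbol m)$$ admits a unique solution $(\rho^*,\boldsymbol m^* )$ within the bounds, such that $M(\rho^* )\ge 0$. (B) The distribution of the solution $\rho^*$ depending on the input $(\hat\rho,\hat{\boldsymbol m})$ is given by the following list. Each row gives, for a range of $\hat\rho$: the interval containing the root of $L$; the sign of $L''$ over that interval (where it is used); and either the initial value $\rho_0$ for Newton's method or directly the optimal value $\rho^*$. Here $$\rho_m=\frac{\alpha+\beta}{2},\qquad C_1=\frac{-1}{2\zeta\mathcal D_\rho}\sum_{j=1}^d(\mathcal D_{m_j}\hat m_j)^2,\qquad C_2=\frac{\beta-\alpha}{2\zeta\mathcal D_\rho}\sum_{j=1}^d(\mathcal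 D_{m_j}\hat m_j)^2,$$ and $\delta$ is a small positive parameter. 1. $M(\rho)=\rho^\xi$, $\xi\in(0,1)$, $\rho\ge0$: - $\hat\rho\le\delta$: root interval $(0,+\infty)$, $L''<0$, $\rho_0=\delta$; - $\hat\rho>\delta$: root interval $(\hat\rho,+\infty)$, $L''<0$, $\rho_0=\hat\rho$. 2. $M(\rho)=\rho$, $\rho\ge0$: - $\hat\rho\le C_1$: root interval $(-\infty,0]$, $\rho^*=0$; - $\hat\rho>C_1$: root interval $(0,+\infty)$, $L''<0$, $\rho_0=0$. 3. $M(\rho)=(\rho-\alpha)^\xi(\beta-\rho)^\xi$, $\xi\in(0,1)$, $\alpha\le\rho\le\beta$: - $\hat\rho<\rho_m$: root interval $(\alpha,\rho_m)$, $L''<0$, $\rho_0=\alpha+\delta$; - $\hat\rho=\rho_m$: root interval $\{\rho_m\}$, $\rho^*=\rho_m$; - $\hat\rho>\rho_m$: root interval $(\rho_m,\beta)$, $L''>0$, $\rho_0=\beta-\delta$. 4. $M(\rho)=(\rho-\alpha)(\beta-\rho)$, $\alpha\le\rho\le\beta$: - $\hat\rho\le\alpha-C_2$: root interval $(-\infty,\alpha]$, $\rho^*=\alpha$; - $\alpha-C_2<\hat\rho<\rho_m$: root interval $(\alpha,\rho_m)$, $L''<0$, $\rho_0=\alpha$; - $\hat\rho=\rho_m$: root interval $\{\rho_m\}$, $\rho^*=\rho_m$; - $\rho_m<\hat\rho<\beta+C_2$: root interval $(\rho_m,\beta)$, $L''>0$, $\rho_0=\beta$; - $\hat\rho\ge\beta+C_2$: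 root interval $[\beta,+\infty)$, $\rho^*=\beta$. (C) Newton's method (for the equation $L(\rho)=0$) with the initial values $\rho_0$ listed in (B) is guaranteed to converge to the desired bounded solution $(\rho^*,\boldsymbol m^* )$, where $\boldsymbol m^*$ is obtained from $\rho^*$ as described in the context.
   Context: The action function associated with the mobility $M$ is $$\varphi(\rho,\boldsymbol m)=\begin{cases}\dfrac{\|\boldsymbol m\|^2}{M(\rho)}, & \text{if } M(\rho)>0,\\[4pt] 0, & \text{if } (M(\rho),\boldsymbol m)=(0,\boldsymbol 0),\\ +\infty, & \text{otherwise,}\end{cases}$$ where $\|\cdot\|$ is the Euclidean norm; values of $\rho$ outside the interval on which $M$ is considered ($[\alpha,\beta]$ for form (I), $[0,+\infty)$ for form (II)) fall under "otherwise". "Within the bounds" means that $\rho^*$ lies in that interval. In the region $M(\rho)>0$, the first-order optimality conditions of the minimization problem give $m_j=\dfrac{M(\rho)\mathcal D_{m_j}\hat m_j}{\mathcal D_{m_j}M(\rho)+\zeta}$ for $j=1,\dots,d$, and, after eliminating $\boldsymbol m$, the scalar equation $L(\rho)=0$ with $$L(\rho):=\mathcal D_\rho(\rho-\hat\rho)-\frac{\zeta M'(\rho)}{2}\sum_{j=1}^d\left(\frac{\mathcal D_{m_j}\hat m_j}{\mathcal D_{m_j}M(\rho)+\zeta}\right)^2 .$$ When $\xi=1$, $M$ is a polynomial and the same formula is used for $L$ at and beyond the endpoints where $M=0$. If $L$ has a root within the bounds, that root is $\rho^*$; otherwise $\rho^*$ is an endpoint at which $M=0$. The vector $\boldsymbol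 m^*$ is then obtained from $\rho^*$ by the relation for $m_j$ above (so $\boldsymbol m^*=\boldsymbol 0$ if $M(\rho^* )=0$). Newton's method is the iteration $\rho_{n+1}=\rho_n-L(\rho_n)/L'(\rho_n)$ started from $\rho_0$.
   Formalization: For m̂=0, L is affine, so these claims are dropped there: strict signs of L''; the root interval (ρ̂,∞); and, if ξ<1 and ρ̂ is at or beyond the nearer endpoint, the root interval and Newton claims. In (C), δ is sufficiently small depending on the input. *)

theory Defs
  imports "HOL-Analysis.Analysis"
begin

datatype mobility =
    Two_Sided (lower: real) (upper: real) (exponent: real)
  | One_Sided (exponent: real)

fun admissible :: "mobility \<Rightarrow> bool" where
  "admissible (Two_Sided \<alpha> \<beta> \<xi>) \<longleftrightarrow> \<alpha> < \<beta> \<and> 0 < \<xi> \<and> \<xi> \<le> 1"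
| "admissible (One_Sided \<xi>) \<longleftrightarrow> 0 < \<xi> \<and> \<xi> \<le> 1"

fun bounds :: "mobility \<Rightarrow> real set" where
  "bounds (Two_Sided \<alpha> \<beta> \<xi>) = {\<alpha>..\<beta>}"
| "bounds (One_Sided \<xi>) = {0..}"

text \<open>For exponent 1 the polynomial is used on the whole real line, because the scalar function
  below is then also considered outside the bounds, where the real power is meaningless. Inside the
  bounds both branches agree at exponent 1.\<close>

fun mob :: "mobility \<Rightarrow> real \<Rightarrow> real" where
  "mob (Two_Sided \<alpha> \<beta> \<xi>) \<rho> =
     (if \<xi> = 1 then (\<rho> - \<alpha>) * (\<beta> - \<rho>) else (\<rho> - \<alpha>) powr \<xi> * (\<beta> - \<rho>) powr \<xi>)"
| "mob (One_Sided \<xi>) \<rho> = (if \<xi> = 1 then \<rho> else \<rho> powr \<xi>)"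

definition action :: "mobility \<Rightarrow> real \<Rightarrow> real ^ 'd \<Rightarrow> ereal" where
  "action F \<rho> m =
     (if \<rho> \<in> bounds F \<and> mob F \<rho> > 0 then ereal ((norm m)\<^sup>2 / mob F \<rho>)
      else if \<rho> \<in> bounds F \<and> mob F \<rho> = 0 \<and> m = 0 then 0
      else \<infinity>)"

definition objective ::
  "mobility \<Rightarrow> real \<Rightarrow> real ^ 'd \<Rightarrow> real \<Rightarrow> real \<Rightarrow> real ^ 'd \<Rightarrow> real \<times> (real ^ 'd) \<Rightarrow> ereal" where
  "objective F D\<^sub>\<rho> D\<^sub>m \<zeta> \<rho>h mh = (\<lambda>(\<rho>, m).
     ereal (1/2 * D\<^sub>\<rho> * (\<rho> - \<rho>h)\<^sup>2 + 1/2 * (\<Sum>j\<in>UNIV. D\<^sub>m $ j * (m $ j - mh $ j)\<^sup>2))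
     + ereal (\<zeta> / 2) * action F \<rho> m)"

definition momentum :: "mobility \<Rightarrow> real ^ 'd \<Rightarrow> real \<Rightarrow> real ^ 'd \<Rightarrow> real \<Rightarrow> real ^ 'd" where
  "momentum F D\<^sub>m \<zeta> mh \<rho> =
     (\<chi> j. mob F \<rho> * D\<^sub>m $ j * mh $ j / (D\<^sub>m $ j * mob F \<rho> + \<zeta>))"

definition scalar_fun ::
  "mobility \<Rightarrow> real \<Rightarrow> real ^ 'd \<Rightarrow> real \<Rightarrow> real \<Rightarrow> real ^ 'd \<Rightarrow> real \<Rightarrow> real" where
  "scalar_fun F D\<^sub>\<rho> D\<^sub>m \<zeta> \<rho>h mh \<rho> =
     D\<^sub>\<rho> * (\<rho> - \<rho>h)
     - \<zeta> * deriv (mob F) \<rho> / 2 * (\<Sum>j\<in>UNIV. (D\<^sub>m $ j * mh $ j / (D\<^sub>m $ j * mob F \<rho> + \<zeta>))\<^sup>2)"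

text \<open>The points at which the formula for the scalar function is meaningful: the region of positive
  mobility and, for exponent 1, all real points that are not poles. A summand with
  \<open>mh $ j = 0\<close> is the zero function and contributes no pole.\<close>

definition scalar_dom :: "mobility \<Rightarrow> real ^ 'd \<Rightarrow> real \<Rightarrow> real ^ 'd \<Rightarrow> real set" where
  "scalar_dom F D\<^sub>m \<zeta> mh =
     {\<rho>. (\<rho> \<in> bounds F \<and> mob F \<rho> > 0)
         \<or> (exponent F = 1 \<and> (\<forall>j. mh $ j \<noteq> 0 \<longrightarrow> D\<^sub>m $ j * mob F \<rho> + \<zeta> \<noteq> 0))}"

definition second_deriv_neg :: "(real \<Rightarrow> real) \<Rightarrow> real set \<Rightarrow> bool" where
  "second_deriv_neg f I \<longleftrightarrow>
     (\<forall>x\<in>I. f differentiable at x \<and> deriv f differentiable at x \<and> deriv (deriv f) x < 0)"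

definition second_deriv_pos :: "(real \<Rightarrow> real) \<Rightarrow> real set \<Rightarrow> bool" where
  "second_deriv_pos f I \<longleftrightarrow>
     (\<forall>x\<in>I. f differentiable at x \<and> deriv f differentiable at x \<and> deriv (deriv f) x > 0)"

definition newton :: "(real \<Rightarrow> real) \<Rightarrow> real \<Rightarrow> nat \<Rightarrow> real" where
  "newton f x0 n = ((\<lambda>x. x - f x / deriv f x) ^^ n) x0"

text \<open>Division by zero and the derivative of a non-differentiable function have dummy values, so
  convergence includes that every step of the iteration is well defined.\<close>

definition newton_converges :: "(real \<Rightarrow> real) \<Rightarrow> real set \<Rightarrow> real \<Rightarrow> real \<Rightarrow> bool" where
  "newton_converges f S x0 x \<longleftrightarrow>
     (\<forall>n. newton f x0 n \<in> S \<and> f differentiable at (newton f x0 n) \<and> deriv f (newton f x0 n) \<noteq> 0)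
     \<and> newton f x0 \<longlonglongrightarrow> x"

end

theory Submission
  imports Defs
begin

text \<open>Minimising over the momentum first, by completing the square, leaves a function of the density
  alone which is strictly convex because the mobility is concave; its derivative is the scalar
  function \<open>L\<close>, and \<open>L' \<ge> D\<^sub>\<rho> > 0\<close> on the bounds. So the minimiser is the
  point where \<open>L\<close> changes sign, and all location claims are read off from the sign of \<open>L\<close> near the
  endpoints and at the midpoint. Up to a positive factor each summand of \<open>L''\<close> is the third
  derivative of \<open>1/u\<close> with \<open>u = D M + \<zeta>\<close>, which is negative where \<open>M' > 0\<close>, \<open>M'' \<le> 0\<close> and
  \<open>M''' \<ge> 0\<close>. There \<open>L\<close> is increasing and concave, so Newton's method increases to the root from
  any point to the left of it. The right half of a two-sided mobility follows by the reflection
  \<open>x \<mapsto> \<alpha> + \<beta> - x\<close>: it fixes the mobility and turns \<open>L\<close> into \<open>- L\<close> for the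
  reflected input.\<close>

section \<open>Newton's method for concave increasing functions\<close>

lemma newton_0: "newton f a 0 = a"
  by (simp add: newton_def)

lemma newton_Suc: "newton f a (Suc n) = newton f a n - f (newton f a n) / deriv f (newton f a n)"
  by (simp add: newton_def)

context
  fixes f f' :: "real \<Rightarrow> real" and a s :: real
  assumes start_le_root: "a \<le> s" and root: "f s = 0"
    and has_deriv: "\<And>x. x \<in> {a..s} \<Longrightarrow> (f has_real_derivative f' x) (at x)"
    and deriv_pos: "\<And>x. x \<in> {a..s} \<Longrightarrow> 0 < f' x"
    and deriv_antimono: "antimono_on {a..s} f'"
begin

lemma deriv_concave_increasing: "x \<in> {a..s} \<Longrightarrow> deriv f x = f' x"
  using has_deriv by (rule DERIV_imp_deriv)

lemma
  assumes "x \<in> {a..s}"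
  shows concave_increasing_nonpos: "f x \<le> 0"
    and concave_increasing_tangent_nonneg: "0 \<le> f x + f' x * (s - x)"
    and concave_increasing_root_unique: "f x = 0 \<Longrightarrow> x = s"
proof -
  have "f x \<le> 0 \<and> 0 \<le> f x + f' x * (s - x) \<and> (f x = 0 \<longrightarrow> x = s)"
  proof (cases "x = s")
    case False
    then have "x < s" using assms by simp
    then obtain z where z: "x < z" "z < s" "f s - f x = (s - x) * f' z"
      using MVT2[of x s f f'] has_deriv assms by auto
    then have "0 < (s - x) * f' z" "(s - x) * f' z \<le> (s - x) * f' x"
      using deriv_pos monotone_onD[OF deriv_antimono, of x z] assms \<open>x < s\<close> by auto
    then show ?thesis using z(3) root by (simp add: mult.commute)
  qed (use root in simp)
  then show "f x \<le> 0" "0 \<le> f x + f' x * (s - x)" "f x = 0 \<Longrightarrow> x = s" by auto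
qed

lemma newton_step_between:
  assumes "x \<in> {a..s}"
  shows "x - f x / deriv f x \<in> {x..s}"
  using concave_increasing_nonpos[OF assms] concave_increasing_tangent_nonneg[OF assms]
    deriv_pos[OF assms]
  by (simp add: deriv_concave_increasing[OF assms] field_simps divide_nonpos_pos)

lemma newton_between: "newton f a n \<in> {a..s}"
proof (induction n)
  case (Suc n)
  then show ?case using newton_step_between[OF Suc] by (auto simp: newton_Suc)
qed (use start_le_root in \<open>simp add: newton_0\<close>)

lemma incseq_newton: "incseq (newton f a)"
  using newton_step_between[OF newton_between] by (intro incseq_SucI) (simp add: newton_Suc)

lemma newton_limit: "\<exists>l\<in>{a..s}. newton f a \<longlonglongrightarrow> l"
proof -
  have "\<forall>n. newton f a n \<le> s" using newton_between by simp
  then obtain l where l: "newton f a \<longlonglongrightarrow> l" by (rule incseq_convergent[OF incseq_newton])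
  have "l \<in> {a..s}"
    using closed_sequentially[OF closed_atLeastAtMost _ l] newton_between by blast
  with l show ?thesis ..
qed

lemma newton_values_tendsto_0: "(\<lambda>n. f (newton f a n)) \<longlonglongrightarrow> 0"
proof -
  obtain l where l: "newton f a \<longlonglongrightarrow> l" using newton_limit ..
  have lower: "f' a * (newton f a n - newton f a (Suc n)) \<le> f (newton f a n)" for n
  proof -
    have "f (newton f a n) = f' (newton f a n) * (newton f a n - newton f a (Suc n))"
      using deriv_pos[OF newton_between[of n]]
      by (simp add: newton_Suc deriv_concave_increasing[OF newton_between])
    moreover have "f' (newton f a n) \<le> f' a"
      using monotone_onD[OF deriv_antimono, of a "newton f a n"] newton_between[of n] start_le_root
      by simp
    ultimately show ?thesis
      using incseq_SucD[OF incseq_newton, of n] by (simp add: mult_right_mono_neg)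
  qed
  have "(\<lambda>n. f' a * (newton f a n - newton f a (Suc n))) \<longlonglongrightarrow> f' a * (l - l)"
    by (intro tendsto_mult_left tendsto_diff l LIMSEQ_Suc[OF l])
  then show ?thesis
    using tendsto_sandwich[of "\<lambda>n. f' a * (newton f a n - newton f a (Suc n))"
        "\<lambda>n. f (newton f a n)" sequentially "\<lambda>_. 0" 0]
      lower concave_increasing_nonpos[OF newton_between]
    by simp
qed

lemma newton_tendsto_root: "newton f a \<longlonglongrightarrow> s"
proof -
  obtain l where l: "newton f a \<longlonglongrightarrow> l" and l_between: "l \<in> {a..s}"
    using newton_limit ..
  have "(\<lambda>n. f (newton f a n)) \<longlonglongrightarrow> f l"
    by (rule isCont_tendsto_compose[OF DERIV_isCont[OF has_deriv[OF l_between]] l])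
  then have "f l = 0" using newton_values_tendsto_0 LIMSEQ_unique by blast
  then show ?thesis using concave_increasing_root_unique[OF l_between] l by simp
qed

lemma newton_converges_concave_increasing:
  assumes "{a..s} \<subseteq> S"
  shows "newton_converges f S a s"
  unfolding newton_converges_def
proof (intro conjI allI newton_tendsto_root)
  fix n
  show "newton f a n \<in> S" using newton_between assms by blast
  show "f differentiable at (newton f a n)"
    using has_deriv[OF newton_between] real_differentiable_def by blast
  show "deriv f (newton f a n) \<noteq> 0"
    using deriv_pos[OF newton_between[of n]]
    by (simp add: deriv_concave_increasing[OF newton_between])
qed

end

section \<open>Point reflections\<close>

lemma DERIV_odd_reflect:
  fixes f g :: "real \<Rightarrow> real"
  assumes "(g has_real_derivative D) (at (c - x))"
    and "open T" "x \<in> T" "\<And>y. y \<in> T \<Longrightarrow> f y = - g (c - y)"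
  shows "(f has_real_derivative D) (at x)"
proof -
  have "((\<lambda>y. - g (c - y)) has_real_derivative - (D * (0 - 1))) (at x)"
    using assms(1) by (intro DERIV_minus DERIV_chain2[of g] derivative_intros)
  then show ?thesis
    using has_field_derivative_transform_within_open[OF _ assms(2,3)] assms(4) by force
qed

lemma second_deriv_pos_reflect:
  fixes f g :: "real \<Rightarrow> real"
  assumes neg: "second_deriv_neg g I" and "open J"
    and I: "\<And>x. x \<in> J \<Longrightarrow> c - x \<in> I" and fg: "\<And>x. x \<in> J \<Longrightarrow> f x = - g (c - x)"
  shows "second_deriv_pos f J"
proof -
  have g: "(g has_real_derivative deriv g (c - x)) (at (c - x))"
    "(deriv g has_real_derivative deriv (deriv g) (c - x)) (at (c - x))"
    "deriv (deriv g) (c - x) < 0" if "x \<in> J" for x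
    using neg I[OF that] by (auto simp: second_deriv_neg_def DERIV_deriv_iff_real_differentiable)
  have f: "(f has_real_derivative deriv g (c - x)) (at x)" if "x \<in> J" for x
    using DERIV_odd_reflect[OF g(1)[OF that] \<open>open J\<close> that fg] .
  have f': "(deriv f has_real_derivative - deriv (deriv g) (c - x)) (at x)" if "x \<in> J" for x
    by (rule DERIV_odd_reflect[OF DERIV_minus[OF g(2)[OF that]] \<open>open J\<close> that])
      (simp add: DERIV_imp_deriv[OF f])
  show ?thesis
    unfolding second_deriv_pos_def
    using f f' g(3) by (auto simp: real_differentiable_def DERIV_imp_deriv[OF f'])
qed

context
  fixes f g :: "real \<Rightarrow> real" and S T :: "real set" and c a s :: real
  assumes converges: "newton_converges g S a s"
    and "open T" and reflected: "\<And>x. x \<in> S \<Longrightarrow> c - x \<in> S \<inter> T"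
    and odd: "\<And>x. x \<in> T \<Longrightarrow> f x = - g (c - x)"
begin

lemma DERIV_newton_reflect:
  "(f has_real_derivative deriv g (newton g a n)) (at (c - newton g a n))"
proof (rule DERIV_odd_reflect[where c = c and T = T])
  show "c - newton g a n \<in> T"
    using converges reflected by (simp add: newton_converges_def)
  show "(g has_real_derivative deriv g (newton g a n)) (at (c - (c - newton g a n)))"
    using converges by (simp add: newton_converges_def DERIV_deriv_iff_real_differentiable)
qed (use \<open>open T\<close> odd in auto)

lemma newton_reflect: "newton f (c - a) = (\<lambda>n. c - newton g a n)"
proof
  fix n
  show "newton f (c - a) n = c - newton g a n"
  proof (induction n)
    case (Suc n)
    have "f (c - newton g a n) = - g (newton g a n)"
      using odd converges reflected by (simp add: newton_converges_def)
    then show ?case using DERIV_imp_deriv[OF DERIV_newton_reflect] by (simp add: newton_Suc Suc)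
  qed (simp add: newton_0)
qed

lemma newton_converges_reflect: "newton_converges f S (c - a) (c - s)"
  unfolding newton_converges_def
proof (intro conjI allI)
  show "newton f (c - a) \<longlonglongrightarrow> c - s"
    using converges by (auto simp: newton_reflect newton_converges_def intro!: tendsto_intros)
  fix n
  show "newton f (c - a) n \<in> S"
    using converges reflected by (auto simp: newton_reflect newton_converges_def)
  show "f differentiable at (newton f (c - a) n)"
    using DERIV_newton_reflect real_differentiable_def by (auto simp: newton_reflect)
  show "deriv f (newton f (c - a) n) \<noteq> 0"
    using converges DERIV_imp_deriv[OF DERIV_newton_reflect]
    by (simp add: newton_reflect newton_converges_def)
qed

end

section \<open>Sign changes of increasing functions\<close>

text \<open>Only the interior counts, so the sign may change at an endpoint where the function does not
  vanish or is singular.\<close>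

definition changes_sign_at :: "(real \<Rightarrow> real) \<Rightarrow> real set \<Rightarrow> real \<Rightarrow> bool" where
  "changes_sign_at f B r \<longleftrightarrow>
     r \<in> B \<and> (\<forall>x\<in>interior B. (x < r \<longrightarrow> f x < 0) \<and> (r < x \<longrightarrow> 0 < f x))"

lemma changes_sign_at_in: "changes_sign_at f B r \<Longrightarrow> r \<in> B"
  and changes_sign_at_neg: "changes_sign_at f B r \<Longrightarrow> x \<in> interior B \<Longrightarrow> x < r \<Longrightarrow> f x < 0"
  and changes_sign_at_pos: "changes_sign_at f B r \<Longrightarrow> x \<in> interior B \<Longrightarrow> r < x \<Longrightarrow> 0 < f x"
  by (auto simp: changes_sign_at_def)

lemma between_in_interior:
  fixes x y z :: real
  assumes "is_interval B" "x \<in> B" "y \<in> B" "x < z" "z < y"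
  shows "z \<in> interior B"
proof (rule interiorI)
  show "{x<..<y} \<subseteq> B" using mem_is_interval_1_I[OF assms(1-3)] by auto
qed (use assms in auto)

lemma bdd_above_negative_values:
  fixes f :: "real \<Rightarrow> real"
  assumes "0 < c"
    and growth: "\<And>x y. x \<in> I \<Longrightarrow> y \<in> I \<Longrightarrow> x < y \<Longrightarrow> f x + c * (y - x) \<le> f y"
  shows "bdd_above {x \<in> I. f x < 0}"
proof (cases "\<exists>x\<in>I. f x < 0")
  case True
  then obtain x where x: "x \<in> I" "f x < 0" by blast
  have "y \<le> x - f x / c" if y: "y \<in> I" "f y < 0" for y
  proof (cases "x < y")
    case True
    then show ?thesis using growth[OF x(1) y(1)] y(2) \<open>0 < c\<close> by (simp add: field_simps)
  next
    case False
    then show ?thesis using divide_neg_pos[OF x(2) \<open>0 < c\<close>] by linarith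
  qed
  then show ?thesis by (intro bdd_aboveI) auto
next
  case False
  then have "{x \<in> I. f x < 0} = {}" by blast
  then show ?thesis by (metis bdd_above_empty)
qed

lemma changes_sign_at_exists:
  fixes f :: "real \<Rightarrow> real"
  assumes B: "closed B" "is_interval B" "B \<noteq> {}" "bdd_below B" and "0 < c"
    and growth: "\<And>x y. x \<in> interior B \<Longrightarrow> y \<in> interior B \<Longrightarrow> x < y \<Longrightarrow> f x + c * (y - x) \<le> f y"
  shows "\<exists>r. changes_sign_at f B r"
proof -
  have less: "f x < f y" if "x \<in> interior B" "y \<in> interior B" "x < y" for x y
    using growth[OF that] mult_pos_pos[of c "y - x"] \<open>0 < c\<close> that(3) by linarith
  define N where "N = insert (Inf B) {x \<in> interior B. f x < 0}"
  have "Inf B \<in> B" using closed_contains_Inf B by blast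
  then have "N \<subseteq> B" using interior_subset by (auto simp: N_def)
  have "bdd_above {x \<in> interior B. f x < 0}"
    using \<open>0 < c\<close> growth by (rule bdd_above_negative_values)
  then have bdd: "bdd_above N" by (simp add: N_def)
  define r where "r = Sup N"
  have "r \<in> B"
    using closed_subset_contains_Sup[OF B(1) \<open>N \<subseteq> B\<close>] bdd by (simp add: r_def N_def)
  have "f x < 0" if x: "x \<in> interior B" "x < r" for x
  proof -
    obtain y where "y \<in> N" "x < y"
      using x(2) less_cSup_iff[of N x] bdd by (auto simp: r_def N_def)
    moreover have "y \<noteq> Inf B"
      using cInf_lower[of x B] B(4) x(1) interior_subset \<open>x < y\<close> by (metis not_less subsetD)
    ultimately show ?thesis using less[OF x(1)] by (auto simp: N_def intro: less_trans)
  qed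
  moreover have "0 < f x" if x: "x \<in> interior B" "r < x" for x
  proof -
    obtain z where z: "r < z" "z < x" using dense x(2) by blast
    then have "z \<in> interior B"
      using between_in_interior[OF B(2) \<open>r \<in> B\<close>] x(1) interior_subset by blast
    moreover have "z \<notin> N" using cSup_upper[OF _ bdd, of z] z(1) by (auto simp: r_def)
    ultimately show ?thesis using less[OF _ x(1) z(2)] by (auto simp: N_def)
  qed
  ultimately show ?thesis using \<open>r \<in> B\<close> by (auto simp: changes_sign_at_def)
qed

lemma changes_sign_at_isCont:
  assumes "changes_sign_at f B r" "r \<in> interior B" "isCont f r"
  shows "f r = 0"
proof (rule antisym)
  have "eventually (\<lambda>x. x \<in> interior B) (nhds r)"
    using assms(2) by (intro eventually_nhds_in_open) auto
  then have neg: "eventually (\<lambda>x. f x < 0) (at_left r)"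
    and pos: "eventually (\<lambda>x. 0 < f x) (at_right r)"
    using changes_sign_at_neg[OF assms(1)] changes_sign_at_pos[OF assms(1)]
    by (auto simp: eventually_at_filter elim: eventually_mono)
  have lim: "(f \<longlongrightarrow> f r) (at r within A)" for A
    using assms(3) continuous_at_imp_continuous_at_within continuous_within by blast
  show "f r \<le> 0"
    by (rule tendsto_upperbound[OF lim eventually_mono[OF neg]]) auto
  show "0 \<le> f r"
    by (rule tendsto_lowerbound[OF lim eventually_mono[OF pos]]) auto
qed

context
  fixes f :: "real \<Rightarrow> real" and B C :: "real set" and r :: real
  assumes change: "changes_sign_at f B r" and "is_interval B"
    and mono: "strict_mono_on C f" and C: "interior B \<subseteq> C" "C \<subseteq> B"
begin

lemma changes_sign_at_le:
  assumes "x \<in> C" "0 \<le> f x"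
  shows "r \<le> x"
proof (rule ccontr)
  assume "\<not> r \<le> x"
  then obtain z where z: "x < z" "z < r" using dense[of x r] by auto
  have "z \<in> interior B"
    using between_in_interior[OF \<open>is_interval B\<close>] assms(1) C(2) changes_sign_at_in[OF change] z
    by blast
  then show False
    using strict_mono_onD[OF mono assms(1) _ z(1)] changes_sign_at_neg[OF change _ z(2)]
      assms(2) C(1)
    by fastforce
qed

lemma changes_sign_at_ge:
  assumes "x \<in> C" "f x \<le> 0"
  shows "x \<le> r"
proof (rule ccontr)
  assume "\<not> x \<le> r"
  then obtain z where z: "r < z" "z < x" using dense[of r x] by auto
  have "z \<in> interior B"
    using between_in_interior[OF \<open>is_interval B\<close>] assms(1) C(2) changes_sign_at_in[OF change] z
    by blast
  then show False
    using strict_mono_onD[OF mono _ assms(1) z(2)] changes_sign_at_pos[OF change _ z(1)]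
      assms(2) C(1)
    by fastforce
qed

lemma changes_sign_at_root: "x \<in> C \<Longrightarrow> f x = 0 \<Longrightarrow> r = x"
  using changes_sign_at_le changes_sign_at_ge by (simp add: antisym)

end

lemma changes_sign_at_strict_minimum:
  fixes f g :: "real \<Rightarrow> real"
  assumes change: "changes_sign_at f B r" and "is_interval B"
    and cont: "continuous_on B g"
    and der: "\<And>x. x \<in> interior B \<Longrightarrow> (g has_real_derivative f x) (at x)"
    and x: "x \<in> B" "x \<noteq> r"
  shows "g r < g x"
proof -
  note r = changes_sign_at_in[OF change]
  have cont_Icc: "continuous_on {a..b} g" if "a \<in> B" "b \<in> B" for a b
    by (rule continuous_on_subset[OF cont])
      (use mem_is_interval_1_I[OF \<open>is_interval B\<close> that] in auto)
  note interior = between_in_interior[OF \<open>is_interval B\<close>]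
  consider "x < r" | "r < x" using x(2) by linarith
  then show ?thesis
  proof cases
    assume "x < r"
    then show ?thesis
      using DERIV_neg_imp_decreasing_open[OF _ _ cont_Icc[OF x(1) r]]
        der interior[OF x(1) r] changes_sign_at_neg[OF change] by blast
  next
    assume "r < x"
    then show ?thesis
      using DERIV_pos_imp_increasing_open[OF _ _ cont_Icc[OF r x(1)]]
        der interior[OF r x(1)] changes_sign_at_pos[OF change] by blast
  qed
qed

lemma changes_sign_at_reflect:
  assumes change: "changes_sign_at g B r"
    and sym: "\<And>x. c - x \<in> B \<longleftrightarrow> x \<in> B" "\<And>x. c - x \<in> interior B \<longleftrightarrow> x \<in> interior B"
    and odd: "\<And>x. x \<in> interior B \<Longrightarrow> f x = - g (c - x)"
  shows "changes_sign_at f B (c - r)"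
  unfolding changes_sign_at_def
proof (intro conjI ballI impI)
  show "c - r \<in> B" using sym(1) changes_sign_at_in[OF change] by blast
  fix x assume x: "x \<in> interior B"
  show "f x < 0" if "x < c - r"
    using odd[OF x] changes_sign_at_pos[OF change, of "c - x"] sym(2) x that by simp
  show "0 < f x" if "c - r < x"
    using odd[OF x] changes_sign_at_neg[OF change, of "c - x"] sym(2) x that by simp
qed

section \<open>Powers and quotients\<close>

text \<open>For exponent 1 the functions below are used on the whole real line, whereas \<open>powr\<close> is not the
  identity at negative arguments.\<close>

definition ext_powr :: "real \<Rightarrow> real \<Rightarrow> real" where
  "ext_powr \<xi> p = (if \<xi> = 1 then p else p powr \<xi>)"

definition ext_powr_deriv :: "real \<Rightarrow> real \<Rightarrow> real" where
  "ext_powr_deriv \<xi> p = (if \<xi> = 1 then 1 else \<xi> * p powr (\<xi> - 1))"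

definition ext_powr_deriv2 :: "real \<Rightarrow> real \<Rightarrow> real" where
  "ext_powr_deriv2 \<xi> p = \<xi> * (\<xi> - 1) * p powr (\<xi> - 2)"

definition ext_powr_deriv3 :: "real \<Rightarrow> real \<Rightarrow> real" where
  "ext_powr_deriv3 \<xi> p = \<xi> * (\<xi> - 1) * (\<xi> - 2) * p powr (\<xi> - 3)"

lemma DERIV_ext_powr:
  assumes "\<xi> = 1 \<or> 0 < p"
  shows "(ext_powr \<xi> has_real_derivative ext_powr_deriv \<xi> p) (at p)"
    and "(ext_powr_deriv \<xi> has_real_derivative ext_powr_deriv2 \<xi> p) (at p)"
    and "(ext_powr_deriv2 \<xi> has_real_derivative ext_powr_deriv3 \<xi> p) (at p)"
proof -
  note powr = has_real_derivative_powr[of p]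
  show "(ext_powr \<xi> has_real_derivative ext_powr_deriv \<xi> p) (at p)"
    using assms powr[of \<xi>] by (cases "\<xi> = 1") (auto simp: ext_powr_def[abs_def] ext_powr_deriv_def)
  show "(ext_powr_deriv \<xi> has_real_derivative ext_powr_deriv2 \<xi> p) (at p)"
    using assms DERIV_cmult[OF powr[of "\<xi> - 1"], of \<xi>]
    by (cases "\<xi> = 1") (auto simp: ext_powr_deriv_def[abs_def] ext_powr_deriv2_def mult.assoc)
  show "(ext_powr_deriv2 \<xi> has_real_derivative ext_powr_deriv3 \<xi> p) (at p)"
    using assms DERIV_cmult[OF powr[of "\<xi> - 2"], of "\<xi> * (\<xi> - 1)"]
    by (cases "\<xi> = 1") (auto simp: ext_powr_deriv2_def[abs_def] ext_powr_deriv3_def mult.assoc)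
qed

lemma ext_powr_deriv_pos: "0 < \<xi> \<Longrightarrow> \<xi> = 1 \<or> 0 < p \<Longrightarrow> 0 < ext_powr_deriv \<xi> p"
  by (auto simp: ext_powr_deriv_def)

lemma ext_powr_deriv_nonneg: "0 < \<xi> \<Longrightarrow> 0 \<le> ext_powr_deriv \<xi> p"
  by (auto simp: ext_powr_deriv_def)

lemma ext_powr_deriv2_nonpos: "0 < \<xi> \<Longrightarrow> \<xi> \<le> 1 \<Longrightarrow> ext_powr_deriv2 \<xi> p \<le> 0"
  by (auto simp: ext_powr_deriv2_def mult_nonneg_nonpos mult_nonpos_nonneg)

lemma ext_powr_deriv3_nonneg: "0 < \<xi> \<Longrightarrow> \<xi> \<le> 1 \<Longrightarrow> 0 \<le> ext_powr_deriv3 \<xi> p"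
  by (auto simp: ext_powr_deriv3_def mult_nonneg_nonpos mult_nonpos_nonpos)

lemma ext_powr_tendsto_0:
  assumes "0 < \<xi>" "(f \<longlongrightarrow> 0) G" "eventually (\<lambda>x. 0 < f x) G"
  shows "((\<lambda>x. ext_powr \<xi> (f x)) \<longlongrightarrow> 0) G"
proof (cases "\<xi> = 1")
  case False
  have "((\<lambda>x. f x powr \<xi>) \<longlongrightarrow> 0) G"
    using assms by (intro tendsto_zero_powrI[where b = \<xi>]) (auto elim: eventually_mono)
  then show ?thesis using False by (simp add: ext_powr_def)
qed (use assms(2) in \<open>simp add: ext_powr_def\<close>)

lemma ext_powr_deriv_at_top:
  assumes "0 < \<xi>" "\<xi> < 1" "(f \<longlongrightarrow> 0) G" "eventually (\<lambda>x. 0 < f x) G"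
  shows "LIM x G. ext_powr_deriv \<xi> (f x) :> at_top"
proof -
  have "LIM x G. inverse (f x powr (1 - \<xi>)) :> at_top"
  proof (rule filterlim_inverse_at_top)
    show "((\<lambda>x. f x powr (1 - \<xi>)) \<longlongrightarrow> 0) G"
      using assms by (intro tendsto_zero_powrI[where b = "1 - \<xi>"]) (auto elim: eventually_mono)
    show "eventually (\<lambda>x. 0 < f x powr (1 - \<xi>)) G"
      using assms(4) by (rule eventually_mono) simp
  qed
  then have "LIM x G. \<xi> * inverse (f x powr (1 - \<xi>)) :> at_top"
    using assms(1) by (intro filterlim_tendsto_pos_mult_at_top[OF tendsto_const]) auto
  then show ?thesis
    using assms(2) by (simp add: ext_powr_deriv_def powr_minus[symmetric])
qed

lemma DERIV_divide_power:
  assumes "(v has_field_derivative v') (at x within A)"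
    and "(u has_field_derivative u') (at x within A)" "u x \<noteq> 0"
  shows "((\<lambda>x. v x / u x ^ n) has_field_derivative
           v' / u x ^ n - of_nat n * v x * u' / u x ^ Suc n) (at x within A)"
proof (cases n)
  case (Suc k)
  have "((\<lambda>x. v x / u x ^ n) has_field_derivative
      (v' * u x ^ n - v x * (of_nat n * (u' * u x ^ (n - Suc 0)))) / (u x ^ n * u x ^ n))
      (at x within A)"
    using assms by (intro DERIV_divide DERIV_power) auto
  then show ?thesis
    by (rule DERIV_cong) (use assms(3) in \<open>simp add: Suc field_simps\<close>)
qed (use assms(1) in simp)

lemma complete_square:
  fixes M D k m z :: "'a :: field_char_0"
  assumes "M \<noteq> 0" "D * M + z \<noteq> 0"
  shows "1/2 * (D * (m - k)\<^sup>2) + z / 2 * (m\<^sup>2 / M)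
    = 1/2 * z * D * k\<^sup>2 / (D * M + z) + 1/2 * (D + z / M) * (m - M * D * k / (D * M + z))\<^sup>2"
proof -
  define U where "U = D * M + z"
  have z: "z = U - D * M" by (simp add: U_def)
  have "U \<noteq> 0" using assms(2) by (simp add: U_def)
  then show ?thesis
    unfolding U_def[symmetric] unfolding z using assms(1)
    by (simp add: field_simps power2_eq_square)
qed

section \<open>Mobilities\<close>

fun profile :: "mobility \<Rightarrow> real \<Rightarrow> real" where
  "profile (Two_Sided \<alpha> \<beta> \<xi>) x = (x - \<alpha>) * (\<beta> - x)"
| "profile (One_Sided \<xi>) x = x"

fun profile_deriv :: "mobility \<Rightarrow> real \<Rightarrow> real" where
  "profile_deriv (Two_Sided \<alpha> \<beta> \<xi>) x = \<alpha> + \<beta> - 2 * x"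
| "profile_deriv (One_Sided \<xi>) x = 1"

fun profile_deriv2 :: "mobility \<Rightarrow> real" where
  "profile_deriv2 (Two_Sided \<alpha> \<beta> \<xi>) = - 2"
| "profile_deriv2 (One_Sided \<xi>) = 0"

fun left_end :: "mobility \<Rightarrow> real" where
  "left_end (Two_Sided \<alpha> \<beta> \<xi>) = \<alpha>"
| "left_end (One_Sided \<xi>) = 0"

definition regular :: "mobility \<Rightarrow> real set" where
  "regular F = {x. exponent F = 1 \<or> 0 < profile F x}"

definition rising :: "mobility \<Rightarrow> real set" where
  "rising F = {x \<in> regular F \<inter> bounds F. 0 < profile_deriv F x}"

definition mob_deriv :: "mobility \<Rightarrow> real \<Rightarrow> real" where
  "mob_deriv F x = ext_powr_deriv (exponent F) (profile F x) * profile_deriv F x"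

definition mob_deriv2 :: "mobility \<Rightarrow> real \<Rightarrow> real" where
  "mob_deriv2 F x =
     ext_powr_deriv2 (exponent F) (profile F x) * (profile_deriv F x)\<^sup>2
     + ext_powr_deriv (exponent F) (profile F x) * profile_deriv2 F"

definition mob_deriv3 :: "mobility \<Rightarrow> real \<Rightarrow> real" where
  "mob_deriv3 F x =
     ext_powr_deriv3 (exponent F) (profile F x) * profile_deriv F x ^ 3
     + 3 * ext_powr_deriv2 (exponent F) (profile F x) * profile_deriv F x * profile_deriv2 F"

lemma mob_eq: "mob F x = ext_powr (exponent F) (profile F x)"
  by (cases F) (auto simp: ext_powr_def powr_mult)

lemma DERIV_profile: "(profile F has_real_derivative profile_deriv F x) (at x)"
proof (cases F)
  case (Two_Sided \<alpha> \<beta> \<xi>)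
  then have "profile F = (\<lambda>x. (x - \<alpha>) * (\<beta> - x))" by auto
  then show ?thesis by (auto simp: Two_Sided intro!: derivative_eq_intros)
next
  case (One_Sided \<xi>)
  then have "profile F = (\<lambda>x. x)" by auto
  then show ?thesis by (simp add: One_Sided)
qed

lemma DERIV_profile_deriv: "(profile_deriv F has_real_derivative profile_deriv2 F) (at x)"
proof (cases F)
  case (Two_Sided \<alpha> \<beta> \<xi>)
  then have "profile_deriv F = (\<lambda>x. \<alpha> + \<beta> - 2 * x)" by auto
  then show ?thesis by (auto simp: Two_Sided intro!: derivative_eq_intros)
next
  case (One_Sided \<xi>)
  then have "profile_deriv F = (\<lambda>x. 1)" by auto
  then show ?thesis by (simp add: One_Sided)
qed

lemma isCont_profile: "isCont (profile F) x"
  using DERIV_profile by (rule DERIV_isCont)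

lemma DERIV_mob:
  assumes "x \<in> regular F"
  shows "(mob F has_real_derivative mob_deriv F x) (at x)"
    and "(mob_deriv F has_real_derivative mob_deriv2 F x) (at x)"
    and "(mob_deriv2 F has_real_derivative mob_deriv3 F x) (at x)"
proof -
  note ext_powr = DERIV_ext_powr[THEN DERIV_chain2, OF _ DERIV_profile, of "exponent F" F x]
  have regular: "exponent F = 1 \<or> 0 < profile F x" using assms by (simp add: regular_def)
  show "(mob F has_real_derivative mob_deriv F x) (at x)"
    unfolding mob_eq[abs_def] mob_deriv_def by (rule ext_powr(1)[OF regular])
  show "(mob_deriv F has_real_derivative mob_deriv2 F x) (at x)"
    unfolding mob_deriv_def[abs_def] mob_deriv2_def
    by (rule DERIV_cong[OF DERIV_mult[OF ext_powr(2)[OF regular] DERIV_profile_deriv]])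
      (simp add: power2_eq_square)
  have "((\<lambda>x. (profile_deriv F x)\<^sup>2) has_real_derivative
      2 * profile_deriv F x * profile_deriv2 F) (at x)"
    by (rule DERIV_cong[OF DERIV_power[OF DERIV_profile_deriv]]) simp
  from DERIV_add[OF DERIV_mult[OF ext_powr(3)[OF regular] this]
      DERIV_cmult_right[OF ext_powr(2)[OF regular], of "profile_deriv2 F"]]
  show "(mob_deriv2 F has_real_derivative mob_deriv3 F x) (at x)"
    unfolding mob_deriv2_def[abs_def] mob_deriv3_def
    by (rule DERIV_cong) (simp add: power2_eq_square power3_eq_cube algebra_simps)
qed

lemma admissible_exponent: "admissible F \<Longrightarrow> 0 < exponent F \<and> exponent F \<le> 1"
  by (cases F) auto

lemma mob_deriv_pos:
  assumes "admissible F" "x \<in> rising F"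
  shows "0 < mob_deriv F x"
  using assms admissible_exponent[OF assms(1)]
  by (auto simp: rising_def regular_def mob_deriv_def intro!: mult_pos_pos ext_powr_deriv_pos)

lemma mob_deriv_nonpos:
  assumes "admissible F" "profile_deriv F x \<le> 0"
  shows "mob_deriv F x \<le> 0"
  using assms admissible_exponent[OF assms(1)]
  by (auto simp: mob_deriv_def intro!: mult_nonneg_nonpos ext_powr_deriv_nonneg)

lemma profile_deriv2_nonpos: "profile_deriv2 F \<le> 0"
  by (cases F) auto

lemma mob_deriv2_nonpos:
  assumes "admissible F"
  shows "mob_deriv2 F x \<le> 0"
  unfolding mob_deriv2_def
proof (intro add_nonpos_nonpos)
  note \<xi> = admissible_exponent[OF assms]
  show "ext_powr_deriv2 (exponent F) (profile F x) * (profile_deriv F x)\<^sup>2 \<le> 0"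
    using \<xi> by (intro mult_nonpos_nonneg ext_powr_deriv2_nonpos) auto
  show "ext_powr_deriv (exponent F) (profile F x) * profile_deriv2 F \<le> 0"
    using \<xi> by (intro mult_nonneg_nonpos ext_powr_deriv_nonneg profile_deriv2_nonpos) auto
qed

lemma mob_deriv3_nonneg:
  assumes "admissible F" "0 \<le> profile_deriv F x"
  shows "0 \<le> mob_deriv3 F x"
  unfolding mob_deriv3_def
proof (intro add_nonneg_nonneg)
  note \<xi> = admissible_exponent[OF assms(1)]
  show "0 \<le> ext_powr_deriv3 (exponent F) (profile F x) * profile_deriv F x ^ 3"
    using \<xi> assms(2) ext_powr_deriv3_nonneg by simp
  show "0 \<le> 3 * ext_powr_deriv2 (exponent F) (profile F x) * profile_deriv F x * profile_deriv2 F"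
    using \<xi> assms(2) ext_powr_deriv2_nonpos
    by (intro mult_nonpos_nonpos[OF _ profile_deriv2_nonpos] mult_nonpos_nonneg[of "3 * _"]) auto
qed

lemma mem_bounds_iff: "admissible F \<Longrightarrow> x \<in> bounds F \<longleftrightarrow> 0 \<le> profile F x"
  by (cases F) (auto simp: zero_le_mult_iff)

lemma mem_interior_bounds_iff: "admissible F \<Longrightarrow> x \<in> interior (bounds F) \<longleftrightarrow> 0 < profile F x"
  by (cases F) (auto simp: zero_less_mult_iff)

lemma is_interval_bounds: "is_interval (bounds F)"
  by (cases F) (auto simp: is_interval_cc is_interval_ci)

lemma closed_bounds: "closed (bounds F)"
  by (cases F) auto

lemma bdd_below_bounds: "bdd_below (bounds F)"
  by (cases F) auto

lemma open_regular: "open (regular F)"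
proof -
  have "continuous_on UNIV (profile F)"
    by (simp add: continuous_at_imp_continuous_on isCont_profile)
  then show ?thesis
    by (cases "exponent F = 1") (auto simp: regular_def intro!: open_Collect_less)
qed

lemma interior_bounds_subset_regular: "admissible F \<Longrightarrow> interior (bounds F) \<subseteq> regular F \<inter> bounds F"
  by (auto simp: mem_interior_bounds_iff mem_bounds_iff regular_def)

lemma regular_bounds_eq_interior:
  "admissible F \<Longrightarrow> exponent F \<noteq> 1 \<Longrightarrow> regular F \<inter> bounds F = interior (bounds F)"
  by (auto simp: mem_interior_bounds_iff mem_bounds_iff regular_def)

lemma is_interval_regular_bounds:
  assumes "admissible F"
  shows "is_interval (regular F \<inter> bounds F)"
proof (cases "exponent F = 1")
  case True
  then show ?thesis by (simp add: regular_def is_interval_bounds)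
next
  case False
  then show ?thesis
    using convex_interior is_interval_bounds
    by (simp add: regular_bounds_eq_interior[OF assms] is_interval_convex_1)
qed

lemma profile_deriv_antimono: "x \<le> y \<Longrightarrow> profile_deriv F y \<le> profile_deriv F x"
  by (cases F) auto

lemma is_interval_rising:
  assumes "admissible F"
  shows "is_interval (rising F)"
  unfolding is_interval_1
proof (intro ballI allI impI)
  fix x y z assume "x \<in> rising F" "y \<in> rising F" "x \<le> z \<and> z \<le> y"
  then show "z \<in> rising F"
    using mem_is_interval_1_I[OF is_interval_regular_bounds[OF assms], of x y z]
      profile_deriv_antimono[of z y F]
    by (auto simp: rising_def)
qed

lemma mob_nonneg: "x \<in> bounds F \<Longrightarrow> 0 \<le> mob F x"
  by (cases F) auto

lemma mob_pos_iff: "admissible F \<Longrightarrow> x \<in> bounds F \<Longrightarrow> 0 < mob F x \<longleftrightarrow> x \<in> interior (bounds F)"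
  by (auto simp: mob_eq ext_powr_def mem_interior_bounds_iff mem_bounds_iff)

lemma continuous_on_mob:
  assumes "admissible F"
  shows "continuous_on (bounds F) (mob F)"
proof -
  have "continuous_on (bounds F) (profile F)"
    by (simp add: continuous_at_imp_continuous_on isCont_profile)
  then show ?thesis
    using admissible_exponent[OF assms]
    by (cases "exponent F = 1")
      (auto simp: mob_eq[abs_def] ext_powr_def mem_bounds_iff[OF assms] intro!: continuous_on_powr')
qed

lemma profile_left_end: "profile F (left_end F) = 0"
  by (cases F) auto

lemma profile_deriv_left_end_pos: "admissible F \<Longrightarrow> 0 < profile_deriv F (left_end F)"
  by (cases F) auto

lemma mob_left_end: "admissible F \<Longrightarrow> mob F (left_end F) = 0"
  by (auto simp: mob_eq profile_left_end ext_powr_def)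

lemma left_end_in_bounds: "admissible F \<Longrightarrow> left_end F \<in> bounds F"
  by (simp add: mem_bounds_iff profile_left_end)

lemma left_end_le: "x \<in> bounds F \<Longrightarrow> left_end F \<le> x"
  by (cases F) auto

lemma eventually_at_right_left_end:
  assumes "admissible F"
  shows "eventually (\<lambda>x. x \<in> interior (bounds F) \<inter> rising F) (at_right (left_end F))"
proof -
  obtain b where b: "left_end F < b"
    "{left_end F<..<b} \<subseteq> {x. 0 < profile F x \<and> 0 < profile_deriv F x}"
  proof (cases F)
    case (Two_Sided \<alpha> \<beta> \<xi>)
    then show ?thesis using assms that[of "(\<alpha> + \<beta>) / 2"] by (auto simp: subset_iff)
  next
    case (One_Sided \<xi>)
    then show ?thesis using that[of 1] by (auto simp: subset_iff)
  qed
  show ?thesis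
    using eventually_at_right_real[OF b(1)] b(2)
    by (force simp: mem_interior_bounds_iff[OF assms] mem_bounds_iff[OF assms] rising_def
        regular_def elim!: eventually_mono)
qed

lemma profile_at_right_left_end:
  assumes "admissible F"
  shows "(profile F \<longlongrightarrow> 0) (at_right (left_end F))"
    and "eventually (\<lambda>x. 0 < profile F x) (at_right (left_end F))"
proof -
  have "(profile F \<longlongrightarrow> profile F (left_end F)) (at (left_end F))"
    using isCont_profile by (simp add: isCont_def)
  then show "(profile F \<longlongrightarrow> 0) (at_right (left_end F))"
    unfolding profile_left_end by (rule Lim_at_imp_Lim_at_within)
  show "eventually (\<lambda>x. 0 < profile F x) (at_right (left_end F))"
    using eventually_at_right_left_end[OF assms]
    by (rule eventually_mono) (simp add: mem_interior_bounds_iff[OF assms])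
qed

lemma mob_tendsto_left_end:
  assumes "admissible F"
  shows "(mob F \<longlongrightarrow> 0) (at_right (left_end F))"
  unfolding mob_eq[abs_def]
  using admissible_exponent[OF assms] profile_at_right_left_end[OF assms]
  by (intro ext_powr_tendsto_0) auto

lemma mob_deriv_at_top:
  assumes "admissible F" "exponent F \<noteq> 1"
  shows "LIM x at_right (left_end F). mob_deriv F x :> at_top"
proof -
  have "LIM x at_right (left_end F). ext_powr_deriv (exponent F) (profile F x) :> at_top"
    using admissible_exponent[OF assms(1)] assms(2) profile_at_right_left_end[OF assms(1)]
    by (intro ext_powr_deriv_at_top) auto
  moreover have "(profile_deriv F \<longlongrightarrow> profile_deriv F (left_end F)) (at (left_end F))"
    using DERIV_isCont[OF DERIV_profile_deriv] by (simp add: isCont_def)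
  then have "(profile_deriv F \<longlongrightarrow> profile_deriv F (left_end F)) (at_right (left_end F))"
    by (rule Lim_at_imp_Lim_at_within)
  ultimately have "LIM x at_right (left_end F).
      profile_deriv F x * ext_powr_deriv (exponent F) (profile F x) :> at_top"
    using filterlim_tendsto_pos_mult_at_top profile_deriv_left_end_pos[OF assms(1)] by blast
  then show ?thesis by (simp add: mob_deriv_def mult.commute)
qed

lemma profile_less_profile_left:
  assumes "admissible F" "x < y" "y \<le> left_end F"
  shows "profile F x < profile F y"
proof (rule DERIV_pos_imp_increasing[OF \<open>x < y\<close>])
  fix z assume "z \<le> y"
  then have "0 < profile_deriv F z"
    using profile_deriv_antimono[of z "left_end F" F] profile_deriv_left_end_pos[OF assms(1)]
      assms(3)
    by simp
  then show "\<exists>d. (profile F has_real_derivative d) (at z) \<and> 0 < d"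
    using DERIV_profile by blast
qed

lemma profile_le_tangent: "profile F x \<le> profile_deriv F (left_end F) * (x - left_end F)"
proof (cases F)
  case (Two_Sided \<alpha> \<beta> \<xi>)
  have "(x - \<alpha>) * (\<beta> - x) = (\<beta> - \<alpha>) * (x - \<alpha>) - (x - \<alpha>)\<^sup>2"
    by (simp add: algebra_simps power2_eq_square)
  then show ?thesis by (simp add: Two_Sided)
qed simp

lemma profile_attains_nonpos:
  assumes "admissible F" "v \<le> 0"
  shows "\<exists>x \<le> left_end F. profile F x = v"
proof -
  define z where "z = left_end F + v / profile_deriv F (left_end F)"
  have "z \<le> left_end F"
    using profile_deriv_left_end_pos[OF assms(1)] assms(2) by (simp add: z_def divide_nonpos_pos)
  moreover have "profile F z \<le> v"
    using profile_le_tangent[of F z] profile_deriv_left_end_pos[OF assms(1)] by (simp add: z_def)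
  ultimately show ?thesis
    using IVT[of "profile F" z v "left_end F"] assms(2) isCont_profile[of _ F]
    by (auto simp: profile_left_end)
qed

lemma profile_reflect: "profile (Two_Sided \<alpha> \<beta> \<xi>) (\<alpha> + \<beta> - x) = profile (Two_Sided \<alpha> \<beta> \<xi>) x"
  by (simp add: mult.commute)

lemma profile_deriv_reflect:
  "profile_deriv (Two_Sided \<alpha> \<beta> \<xi>) (\<alpha> + \<beta> - x) = - profile_deriv (Two_Sided \<alpha> \<beta> \<xi>) x"
  by simp

section \<open>The scalar function\<close>

locale mobility_problem =
  fixes F :: mobility and D\<^sub>\<rho> \<zeta> :: real and D\<^sub>m mh :: "real ^ 'd"
  assumes D\<^sub>\<rho>_pos: "D\<^sub>\<rho> > 0" and D\<^sub>m_pos: "\<And>j. D\<^sub>m $ j > 0" and \<zeta>_pos: "\<zeta> > 0"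
    and admissible: "admissible F"
begin

abbreviation L :: "real \<Rightarrow> real \<Rightarrow> real" where
  "L h \<equiv> scalar_fun F D\<^sub>\<rho> D\<^sub>m \<zeta> h mh"

abbreviation S :: "real set" where
  "S \<equiv> scalar_dom F D\<^sub>m \<zeta> mh"

abbreviation mom :: "real \<Rightarrow> real ^ 'd" where
  "mom \<equiv> momentum F D\<^sub>m \<zeta> mh"

abbreviation J :: "real \<Rightarrow> real \<times> (real ^ 'd) \<Rightarrow> ereal" where
  "J h \<equiv> objective F D\<^sub>\<rho> D\<^sub>m \<zeta> h mh"

definition weight :: "'d \<Rightarrow> real" where
  "weight j = (D\<^sub>m $ j * mh $ j)\<^sup>2"

definition denom :: "'d \<Rightarrow> real \<Rightarrow> real" where
  "denom j x = D\<^sub>m $ j * mob F x + \<zeta>"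

text \<open>Up to the factor \<open>D\<^sub>m $ j\<close>, this is the derivative of \<open>- 1 / denom j\<close>.\<close>

definition slope :: "'d \<Rightarrow> real \<Rightarrow> real" where
  "slope j x = mob_deriv F x / denom j x ^ 2"

definition slope_deriv :: "'d \<Rightarrow> real \<Rightarrow> real" where
  "slope_deriv j x =
     mob_deriv2 F x / denom j x ^ 2 - 2 * D\<^sub>m $ j * (mob_deriv F x)\<^sup>2 / denom j x ^ 3"

definition slope_deriv2 :: "'d \<Rightarrow> real \<Rightarrow> real" where
  "slope_deriv2 j x =
     mob_deriv3 F x / denom j x ^ 2
     - 6 * D\<^sub>m $ j * mob_deriv F x * mob_deriv2 F x / denom j x ^ 3
     + 6 * (D\<^sub>m $ j)\<^sup>2 * mob_deriv F x ^ 3 / denom j x ^ 4"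

definition L_deriv :: "real \<Rightarrow> real" where
  "L_deriv x = D\<^sub>\<rho> - \<zeta> / 2 * (\<Sum>j\<in>UNIV. weight j * slope_deriv j x)"

definition L_deriv2 :: "real \<Rightarrow> real" where
  "L_deriv2 x = - (\<zeta> / 2 * (\<Sum>j\<in>UNIV. weight j * slope_deriv2 j x))"

definition pole_free :: "real set" where
  "pole_free = {x \<in> regular F. \<forall>j. mh $ j \<noteq> 0 \<longrightarrow> 0 < denom j x}"

lemma weight_nonneg: "0 \<le> weight j"
  by (simp add: weight_def)

lemma weight_pos: "mh $ j \<noteq> 0 \<Longrightarrow> 0 < weight j"
  using D\<^sub>m_pos[of j] by (simp add: weight_def)

lemma weighted_sum_nonneg: "(\<And>j. 0 \<le> g j) \<Longrightarrow> 0 \<le> (\<Sum>j\<in>UNIV. weight j * g j)"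
  by (simp add: sum_nonneg weight_nonneg)

lemma weighted_sum_pos:
  assumes "mh \<noteq> 0" "\<And>j. 0 < g j"
  shows "0 < (\<Sum>j\<in>UNIV. weight j * g j)"
proof -
  obtain i where "mh $ i \<noteq> 0" using assms(1) by (auto simp: vec_eq_iff)
  then show ?thesis
    using assms(2) weight_nonneg
    by (intro sum_pos2[of UNIV i] mult_pos_pos weight_pos) (auto simp: less_imp_le)
qed

lemma denom_pos: "x \<in> bounds F \<Longrightarrow> 0 < denom j x"
  using mob_nonneg[of x F] D\<^sub>m_pos[of j] \<zeta>_pos by (simp add: denom_def add_nonneg_pos)

lemma L_eq:
  assumes "x \<in> regular F"
  shows "L h x = D\<^sub>\<rho> * (x - h) - \<zeta> / 2 * (\<Sum>j\<in>UNIV. weight j * slope j x)"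
proof -
  have "deriv (mob F) x = mob_deriv F x" using DERIV_mob(1)[OF assms] by (rule DERIV_imp_deriv)
  then show ?thesis
    by (simp add: scalar_fun_def weight_def denom_def slope_def power_divide sum_distrib_left
        mult_ac)
qed

lemma L_mh_0: "mh = 0 \<Longrightarrow> L h x = D\<^sub>\<rho> * (x - h)"
  by (simp add: scalar_fun_def)

lemma pole_free_subset_regular: "pole_free \<subseteq> regular F"
  by (auto simp: pole_free_def)

lemma regular_bounds_subset_pole_free: "regular F \<inter> bounds F \<subseteq> pole_free"
  using denom_pos by (auto simp: pole_free_def)

lemma rising_subset_pole_free: "rising F \<subseteq> pole_free"
  using regular_bounds_subset_pole_free by (auto simp: rising_def)

lemma DERIV_denom: "x \<in> regular F \<Longrightarrow> (denom j has_real_derivative D\<^sub>m $ j * mob_deriv F x) (at x)"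
  unfolding denom_def[abs_def] using DERIV_mob(1) by (auto intro!: derivative_eq_intros)

lemma open_pole_free: "open pole_free"
proof -
  have "continuous_on (regular F) (denom j)" for j
    using DERIV_denom DERIV_isCont by (blast intro: continuous_at_imp_continuous_on)
  then have "open (regular F \<inter> denom j -` {0<..})" for j
    by (intro continuous_open_preimage open_regular) auto
  then have "open (regular F \<inter> (\<Inter>j\<in>{j. mh $ j \<noteq> 0}. regular F \<inter> denom j -` {0<..}))"
    by (intro open_Int open_regular open_INT) auto
  moreover have "pole_free = regular F \<inter> (\<Inter>j\<in>{j. mh $ j \<noteq> 0}. regular F \<inter> denom j -` {0<..})"
    by (auto simp: pole_free_def)
  ultimately show ?thesis by simp
qed

lemma DERIV_slope:
  assumes "x \<in> regular F" "denom j x \<noteq> 0"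
  shows "(slope j has_real_derivative slope_deriv j x) (at x)"
    and "(slope_deriv j has_real_derivative slope_deriv2 j x) (at x)"
proof -
  note quotient = DERIV_divide_power[OF _ DERIV_denom[OF assms(1)] assms(2)]
  note mob = DERIV_mob[OF assms(1)]
  show "(slope j has_real_derivative slope_deriv j x) (at x)"
    unfolding slope_def[abs_def] slope_deriv_def
    by (rule DERIV_cong[OF quotient[OF mob(2)]]) (simp add: power2_eq_square power3_eq_cube mult_ac)
  have "((\<lambda>x. 2 * D\<^sub>m $ j * (mob_deriv F x)\<^sup>2) has_real_derivative
      4 * D\<^sub>m $ j * mob_deriv F x * mob_deriv2 F x) (at x)"
    by (rule DERIV_cong[OF DERIV_cmult[OF DERIV_power[OF mob(2)]]]) simp
  from DERIV_diff[OF quotient[OF mob(3), of 2] quotient[OF this, of 3]]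
  show "(slope_deriv j has_real_derivative slope_deriv2 j x) (at x)"
    unfolding slope_deriv_def[abs_def] slope_deriv2_def
    by (rule DERIV_cong) (simp add: numeral_eq_Suc field_simps)
qed

lemma DERIV_weight_slope:
  assumes "x \<in> pole_free"
  shows "((\<lambda>x. weight j * slope j x) has_real_derivative weight j * slope_deriv j x) (at x)"
    and "((\<lambda>x. weight j * slope_deriv j x) has_real_derivative weight j * slope_deriv2 j x) (at x)"
proof -
  consider "weight j = 0" | "denom j x \<noteq> 0"
    using assms by (force simp: pole_free_def weight_def)
  then show "((\<lambda>x. weight j * slope j x) has_real_derivative weight j * slope_deriv j x) (at x)"
    and "((\<lambda>x. weight j * slope_deriv j x) has_real_derivative weight j * slope_deriv2 j x) (at x)"
    using assms pole_free_subset_regular by (cases; auto intro!: DERIV_cmult DERIV_slope)+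
qed

lemma DERIV_L:
  assumes "x \<in> pole_free"
  shows "(L h has_real_derivative L_deriv x) (at x)"
proof -
  have "((\<lambda>x. D\<^sub>\<rho> * (x - h) - \<zeta> / 2 * (\<Sum>j\<in>UNIV. weight j * slope j x))
      has_real_derivative L_deriv x) (at x)"
    unfolding L_deriv_def
    by (intro DERIV_diff DERIV_cmult DERIV_sum DERIV_weight_slope assms)
      (auto intro!: derivative_eq_intros)
  then show ?thesis
    by (rule has_field_derivative_transform_within_open[OF _ open_regular])
      (use assms pole_free_subset_regular in \<open>auto simp: L_eq\<close>)
qed

lemma DERIV_L_deriv:
  assumes "x \<in> pole_free"
  shows "(L_deriv has_real_derivative L_deriv2 x) (at x)"
proof -
  have "((\<lambda>x. D\<^sub>\<rho> - \<zeta> / 2 * (\<Sum>j\<in>UNIV. weight j * slope_deriv j x))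
      has_real_derivative 0 - - L_deriv2 x) (at x)"
    unfolding L_deriv2_def minus_minus
    by (intro DERIV_diff DERIV_cmult DERIV_sum DERIV_weight_slope assms DERIV_const)
  then show ?thesis by (simp add: L_deriv_def[abs_def])
qed

lemma isCont_L: "x \<in> pole_free \<Longrightarrow> isCont (L h) x"
  using DERIV_L by (rule DERIV_isCont)

lemma L_deriv_ge:
  assumes "x \<in> bounds F"
  shows "D\<^sub>\<rho> \<le> L_deriv x"
proof -
  have "0 \<le> - slope_deriv j x" for j
  proof -
    note denom = denom_pos[OF assms, of j]
    have "mob_deriv2 F x / denom j x ^ 2 \<le> 0"
      using mob_deriv2_nonpos[OF admissible] denom by (simp add: divide_nonpos_pos)
    moreover have "0 \<le> 2 * D\<^sub>m $ j * (mob_deriv F x)\<^sup>2 / denom j x ^ 3"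
      using D\<^sub>m_pos[of j] denom by simp
    ultimately show ?thesis by (simp add: slope_deriv_def)
  qed
  then have "0 \<le> (\<Sum>j\<in>UNIV. weight j * - slope_deriv j x)" by (rule weighted_sum_nonneg)
  then show ?thesis
    using \<zeta>_pos by (simp add: L_deriv_def sum_negf mult_nonneg_nonpos)
qed

lemma slope_pos:
  assumes "x \<in> rising F"
  shows "0 < slope j x"
  using mob_deriv_pos[OF admissible assms] denom_pos[of x j] assms
  by (simp add: slope_def rising_def)

lemma slope_deriv2_pos:
  assumes "x \<in> rising F"
  shows "0 < slope_deriv2 j x"
proof -
  have x: "x \<in> bounds F" "0 \<le> profile_deriv F x" using assms by (auto simp: rising_def)
  note pos = denom_pos[OF x(1), of j] mob_deriv_pos[OF admissible assms] D\<^sub>m_pos[of j]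
  have "0 \<le> mob_deriv3 F x / denom j x ^ 2"
    using mob_deriv3_nonneg[OF admissible x(2)] by simp
  moreover have "6 * D\<^sub>m $ j * mob_deriv F x * mob_deriv2 F x / denom j x ^ 3 \<le> 0"
    using mob_deriv2_nonpos[OF admissible, of x] pos
    by (intro divide_nonpos_pos mult_nonneg_nonpos) auto
  moreover have "0 < 6 * (D\<^sub>m $ j)\<^sup>2 * mob_deriv F x ^ 3 / denom j x ^ 4"
    using pos by simp
  ultimately show ?thesis unfolding slope_deriv2_def by linarith
qed

lemma L_deriv2_nonpos: "x \<in> rising F \<Longrightarrow> L_deriv2 x \<le> 0"
  using weighted_sum_nonneg[OF less_imp_le[OF slope_deriv2_pos]] \<zeta>_pos by (simp add: L_deriv2_def)

lemma L_deriv2_neg: "mh \<noteq> 0 \<Longrightarrow> x \<in> rising F \<Longrightarrow> L_deriv2 x < 0"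
  using weighted_sum_pos[OF _ slope_deriv2_pos] \<zeta>_pos by (simp add: L_deriv2_def)

lemma second_deriv_neg_L:
  assumes "mh \<noteq> 0" "I \<subseteq> rising F"
  shows "second_deriv_neg (L h) I"
  unfolding second_deriv_neg_def
proof
  fix x assume "x \<in> I"
  then have x: "x \<in> rising F" "x \<in> pole_free" using assms(2) rising_subset_pole_free by auto
  have "(deriv (L h) has_real_derivative L_deriv2 x) (at x)"
    using DERIV_L_deriv[OF x(2)] open_pole_free x(2)
    by (rule has_field_derivative_transform_within_open) (simp add: DERIV_imp_deriv[OF DERIV_L])
  then show "L h differentiable at x \<and> deriv (L h) differentiable at x \<and> deriv (deriv (L h)) x < 0"
    using DERIV_L[OF x(2), of h] L_deriv2_neg[OF assms(1) x(1)]
    by (auto simp: real_differentiable_def dest: DERIV_imp_deriv)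
qed

lemma L_growth:
  assumes "x \<in> regular F \<inter> bounds F" "y \<in> regular F \<inter> bounds F" "x < y"
  shows "L h x + D\<^sub>\<rho> * (y - x) \<le> L h y"
proof -
  have between: "z \<in> regular F \<inter> bounds F" if "x \<le> z" "z \<le> y" for z
    using mem_is_interval_1_I[OF is_interval_regular_bounds[OF admissible] assms(1,2) that] .
  then obtain z where z: "x < z" "z < y" "L h y - L h x = (y - x) * L_deriv z"
    using MVT2[OF assms(3), of "L h" L_deriv] DERIV_L regular_bounds_subset_pole_free by blast
  have "(y - x) * D\<^sub>\<rho> \<le> (y - x) * L_deriv z"
    using between[of z] z(1,2) assms(3) by (intro mult_left_mono L_deriv_ge) auto
  then show ?thesis using z(3) by (simp add: mult.commute)
qed

lemma strict_mono_on_L: "strict_mono_on (regular F \<inter> bounds F) (L h)"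
proof (rule strict_mono_onI)
  fix x y assume "x \<in> regular F \<inter> bounds F" "y \<in> regular F \<inter> bounds F" "x < y"
  moreover from this have "0 < D\<^sub>\<rho> * (y - x)" using D\<^sub>\<rho>_pos by simp
  ultimately show "L h x < L h y" using L_growth[of x y h] by linarith
qed

section \<open>The minimiser\<close>

definition stationary :: "real \<Rightarrow> real \<Rightarrow> bool" where
  "stationary h r \<longleftrightarrow> changes_sign_at (L h) (bounds F) r"

definition roots :: "real \<Rightarrow> real set" where
  "roots h = {x \<in> S. L h x = 0}"

lemma interior_subset_pole_free: "interior (bounds F) \<subseteq> pole_free"
  using interior_bounds_subset_regular[OF admissible] regular_bounds_subset_pole_free by blast

lemma stationary_exists: "\<exists>r. stationary h r"
  unfolding stationary_def
proof (rule changes_sign_at_exists)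
  show "bounds F \<noteq> {}" using left_end_in_bounds[OF admissible] by blast
  show "L h x + D\<^sub>\<rho> * (y - x) \<le> L h y"
    if "x \<in> interior (bounds F)" "y \<in> interior (bounds F)" "x < y" for x y
    using that interior_bounds_subset_regular[OF admissible] by (intro L_growth) auto
qed (auto simp: closed_bounds is_interval_bounds bdd_below_bounds D\<^sub>\<rho>_pos)

lemma stationary_in_bounds: "stationary h r \<Longrightarrow> r \<in> bounds F"
  unfolding stationary_def by (rule changes_sign_at_in)

lemma L_stationary: "stationary h r \<Longrightarrow> r \<in> interior (bounds F) \<Longrightarrow> L h r = 0"
  using interior_subset_pole_free isCont_L changes_sign_at_isCont unfolding stationary_def by blast

lemma
  assumes "stationary h r" "x \<in> regular F \<inter> bounds F"
  shows stationary_le: "0 \<le> L h x \<Longrightarrow> r \<le> x"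
    and stationary_ge: "L h x \<le> 0 \<Longrightarrow> x \<le> r"
    and stationary_root: "L h x = 0 \<Longrightarrow> r = x"
proof -
  note sign_change = assms(1)[unfolded stationary_def] is_interval_bounds strict_mono_on_L
    interior_bounds_subset_regular[OF admissible] Int_lower2 assms(2)
  show "0 \<le> L h x \<Longrightarrow> r \<le> x" by (rule changes_sign_at_le[OF sign_change])
  show "L h x \<le> 0 \<Longrightarrow> x \<le> r" by (rule changes_sign_at_ge[OF sign_change])
  show "L h x = 0 \<Longrightarrow> r = x" by (rule changes_sign_at_root[OF sign_change])
qed

lemma scalar_dom_subset_regular: "S \<subseteq> regular F"
  using mob_pos_iff[OF admissible]
  by (auto simp: scalar_dom_def regular_def mem_interior_bounds_iff[OF admissible])

lemma pole_free_subset_scalar_dom: "exponent F = 1 \<Longrightarrow> pole_free \<subseteq> S"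
  by (force simp: pole_free_def scalar_dom_def denom_def)

lemma regular_bounds_subset_scalar_dom: "regular F \<inter> bounds F \<subseteq> S"
proof (cases "exponent F = 1")
  case True
  then show ?thesis using regular_bounds_subset_pole_free pole_free_subset_scalar_dom by blast
next
  case False
  then show ?thesis
    using mob_pos_iff[OF admissible] regular_bounds_eq_interior[OF admissible]
    by (auto simp: scalar_dom_def)
qed

lemma root_in_bounds_eq:
  assumes "stationary h r" "x \<in> roots h \<inter> bounds F"
  shows "r = x"
  using stationary_root[OF assms(1), of x] assms(2) scalar_dom_subset_regular
  by (auto simp: roots_def)

lemma roots_in_bounds:
  assumes "stationary h r" "r \<in> interior (bounds F)"
  shows "roots h \<inter> bounds F = {r}"
proof -
  have "r \<in> roots h \<inter> bounds F"
    using L_stationary[OF assms] assms(2) interior_bounds_subset_regular[OF admissible]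
      regular_bounds_subset_scalar_dom by (auto simp: roots_def)
  then show ?thesis using root_in_bounds_eq[OF assms(1)] by blast
qed

definition reduced_objective :: "real \<Rightarrow> real \<Rightarrow> real" where
  "reduced_objective h x =
     1/2 * D\<^sub>\<rho> * (x - h)\<^sup>2 + (\<Sum>j\<in>UNIV. 1/2 * \<zeta> * D\<^sub>m $ j * (mh $ j)\<^sup>2 / denom j x)"

lemma DERIV_reduced_objective:
  assumes "x \<in> regular F \<inter> bounds F"
  shows "(reduced_objective h has_real_derivative L h x) (at x)"
proof -
  have "((\<lambda>x. 1/2 * \<zeta> * D\<^sub>m $ j * (mh $ j)\<^sup>2 / denom j x) has_real_derivative
      - (\<zeta> / 2 * (weight j * slope j x))) (at x)" for j
    using denom_pos[of x j] assms
    by (auto intro!: derivative_eq_intros DERIV_denom simp: weight_def slope_def)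
      (simp add: field_simps power2_eq_square)
  then have "((\<lambda>x. 1/2 * D\<^sub>\<rho> * (x - h)\<^sup>2 + (\<Sum>j\<in>UNIV. 1/2 * \<zeta> * D\<^sub>m $ j * (mh $ j)\<^sup>2 / denom j x))
      has_real_derivative D\<^sub>\<rho> * (x - h) + (\<Sum>j\<in>UNIV. - (\<zeta> / 2 * (weight j * slope j x)))) (at x)"
    by (intro DERIV_add DERIV_sum) (auto intro!: derivative_eq_intros)
  then show ?thesis
    using assms by (simp add: reduced_objective_def[abs_def] L_eq sum_negf sum_distrib_left)
qed

lemma continuous_on_reduced_objective: "continuous_on (bounds F) (reduced_objective h)"
proof -
  have "denom j x \<noteq> 0" if "x \<in> bounds F" for j x using denom_pos[OF that, of j] by simp
  then show ?thesis
    unfolding reduced_objective_def[abs_def] denom_def[abs_def]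
    by (intro continuous_intros continuous_on_mob[OF admissible]) auto
qed

lemma reduced_objective_less:
  assumes "stationary h r" "x \<in> bounds F" "x \<noteq> r"
  shows "reduced_objective h r < reduced_objective h x"
  using assms(1)[unfolded stationary_def] is_interval_bounds continuous_on_reduced_objective _
    assms(2,3)
proof (rule changes_sign_at_strict_minimum)
  show "(reduced_objective h has_real_derivative L h x) (at x)" if "x \<in> interior (bounds F)" for x
    using that interior_bounds_subset_regular[OF admissible]
    by (blast intro: DERIV_reduced_objective)
qed

lemma objective_mob_pos:
  assumes "x \<in> bounds F" "0 < mob F x"
  shows "J h (x, m) =
    ereal (reduced_objective h x
      + (\<Sum>j\<in>UNIV. 1/2 * (D\<^sub>m $ j + \<zeta> / mob F x) * (m $ j - mom x $ j)\<^sup>2))"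
proof -
  have "(norm m)\<^sup>2 = (\<Sum>j\<in>UNIV. (m $ j)\<^sup>2)"
    unfolding power2_norm_eq_inner inner_vec_def by (simp add: power2_eq_square)
  then have "1/2 * (\<Sum>j\<in>UNIV. D\<^sub>m $ j * (m $ j - mh $ j)\<^sup>2) + \<zeta> / 2 * ((norm m)\<^sup>2 / mob F x)
      = (\<Sum>j\<in>UNIV. 1/2 * (D\<^sub>m $ j * (m $ j - mh $ j)\<^sup>2) + \<zeta> / 2 * ((m $ j)\<^sup>2 / mob F x))"
    by (simp add: sum.distrib sum_distrib_left sum_divide_distrib)
  also have "\<dots> = (\<Sum>j\<in>UNIV. 1/2 * \<zeta> * D\<^sub>m $ j * (mh $ j)\<^sup>2 / denom j x
      + 1/2 * (D\<^sub>m $ j + \<zeta> / mob F x) * (m $ j - mom x $ j)\<^sup>2)"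
  proof (rule sum.cong[OF refl])
    fix j
    show "1/2 * (D\<^sub>m $ j * (m $ j - mh $ j)\<^sup>2) + \<zeta> / 2 * ((m $ j)\<^sup>2 / mob F x)
      = 1/2 * \<zeta> * D\<^sub>m $ j * (mh $ j)\<^sup>2 / denom j x
        + 1/2 * (D\<^sub>m $ j + \<zeta> / mob F x) * (m $ j - mom x $ j)\<^sup>2"
      using complete_square[of "mob F x" "D\<^sub>m $ j" \<zeta>] assms(2) denom_pos[OF assms(1), of j]
      by (simp add: momentum_def denom_def)
  qed
  finally show ?thesis
    using assms by (simp add: objective_def action_def reduced_objective_def sum.distrib)
qed

lemma objective_mob_0:
  assumes "x \<in> bounds F" "mob F x = 0"
  shows "J h (x, m) = (if m = 0 then ereal (reduced_objective h x) else \<infinity>)"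
proof -
  have "1/2 * (\<Sum>j\<in>UNIV. D\<^sub>m $ j * (0 - mh $ j)\<^sup>2)
      = (\<Sum>j\<in>UNIV. 1/2 * \<zeta> * D\<^sub>m $ j * (mh $ j)\<^sup>2 / denom j x)"
    using assms(2) \<zeta>_pos by (simp add: denom_def sum_distrib_left)
  then show ?thesis
    using assms \<zeta>_pos by (simp add: objective_def action_def reduced_objective_def)
qed

lemma objective_outside: "x \<notin> bounds F \<Longrightarrow> J h (x, m) = \<infinity>"
  using \<zeta>_pos by (simp add: objective_def action_def)

lemma mom_mob_0: "mob F x = 0 \<Longrightarrow> mom x = 0"
  by (simp add: momentum_def vec_eq_iff)

lemma objective_mom:
  assumes "x \<in> bounds F"
  shows "J h (x, mom x) = ereal (reduced_objective h x)"
  using assms mob_nonneg[OF assms]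
  by (cases "mob F x = 0") (simp_all add: objective_mob_0 mom_mob_0 objective_mob_pos)

lemma objective_gt_reduced_objective:
  assumes "x \<in> bounds F" "m \<noteq> mom x"
  shows "ereal (reduced_objective h x) < J h (x, m)"
proof (cases "mob F x = 0")
  case False
  then have mob: "0 < mob F x" using mob_nonneg[OF assms(1)] by simp
  obtain i where "m $ i \<noteq> mom x $ i" using assms(2) by (auto simp: vec_eq_iff)
  moreover have "0 < D\<^sub>m $ j + \<zeta> / mob F x" for j
    using D\<^sub>m_pos[of j] \<zeta>_pos mob by (simp add: add_pos_pos)
  ultimately have "0 < (\<Sum>j\<in>UNIV. 1/2 * (D\<^sub>m $ j + \<zeta> / mob F x) * (m $ j - mom x $ j)\<^sup>2)"
    by (intro sum_pos2[of _ i]) (auto simp: less_imp_le)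
  then show ?thesis by (simp add: objective_mob_pos[OF assms(1) mob])
qed (use assms in \<open>simp add: objective_mob_0 mom_mob_0\<close>)

lemma objective_less:
  assumes r: "stationary h r" and "p \<noteq> (r, mom r)"
  shows "J h (r, mom r) < J h p"
proof (cases p)
  case p: (Pair x m)
  have minimum: "J h (r, mom r) = ereal (reduced_objective h r)"
    by (rule objective_mom[OF stationary_in_bounds[OF r]])
  consider "x \<notin> bounds F" | "x \<in> bounds F" "m \<noteq> mom x" | "x \<in> bounds F" "m = mom x" "x \<noteq> r"
    using assms(2) p by blast
  then show ?thesis
  proof cases
    case 1
    then show ?thesis by (simp add: minimum p objective_outside)
  next
    case 2
    have "ereal (reduced_objective h r) \<le> ereal (reduced_objective h x)"
      using reduced_objective_less[OF r 2(1)] by (cases "x = r") auto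
    then show ?thesis
      unfolding minimum p using objective_gt_reduced_objective[OF 2] by (rule order.strict_trans1)
  next
    case 3
    then show ?thesis using reduced_objective_less[OF r] by (simp add: minimum p objective_mom)
  qed
qed

lemma is_arg_min_iff:
  assumes "stationary h r"
  shows "is_arg_min (J h) (\<lambda>_. True) p \<longleftrightarrow> p = (r, mom r)"
  unfolding is_arg_min_def using objective_less[OF assms] by (metis less_asym less_irrefl)

lemma mob_eq_0_if_no_root:
  assumes "stationary h r" "roots h \<inter> bounds F = {}"
  shows "mob F r = 0"
proof -
  note r = stationary_in_bounds[OF assms(1)]
  have "r \<notin> interior (bounds F)" using roots_in_bounds[OF assms(1)] assms(2) by auto
  then show ?thesis using mob_pos_iff[OF admissible r] mob_nonneg[OF r] by simp
qed

section \<open>Location of the minimiser\<close>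

definition negative_at_left_end :: "real \<Rightarrow> bool" where
  "negative_at_left_end h \<longleftrightarrow> eventually (\<lambda>x. L h x < 0) (at_right (left_end F))"

text \<open>A single summand that tends to infinity drives the scalar function to minus infinity. It does
  so at the endpoint for exponents below 1, and at a pole beyond the endpoint for exponent 1.\<close>

lemma eventually_L_neg:
  assumes i: "mh $ i \<noteq> 0" and lim: "LIM x at_right a. slope i x :> at_top"
    and ev: "eventually (\<lambda>x. x \<in> regular F \<and> 0 \<le> mob_deriv F x) (at_right a)"
  shows "eventually (\<lambda>x. L h x < 0) (at_right a)"
proof -
  have "eventually (\<lambda>x. 2 * D\<^sub>\<rho> * (a + 1 - h) / (\<zeta> * weight i) < slope i x) (at_right a)"
    using lim by (simp add: filterlim_at_top_dense)
  moreover have "eventually (\<lambda>x. x \<in> {a<..<a + 1}) (at_right a)"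
    by (rule eventually_at_right_real) simp
  ultimately show ?thesis
    using ev
  proof eventually_elim
    case (elim x)
    have "D\<^sub>\<rho> * (x - h) \<le> D\<^sub>\<rho> * (a + 1 - h)"
      using elim(2) D\<^sub>\<rho>_pos by (intro mult_left_mono) auto
    also have "\<dots> < \<zeta> / 2 * (weight i * slope i x)"
      using elim(1) weight_pos[OF i] \<zeta>_pos by (simp add: field_simps)
    also have "weight i * slope i x \<le> (\<Sum>j\<in>UNIV. weight j * slope j x)"
      using elim(3) by (intro member_le_sum) (auto simp: weight_nonneg slope_def)
    then have "\<zeta> / 2 * (weight i * slope i x) \<le> \<zeta> / 2 * (\<Sum>j\<in>UNIV. weight j * slope j x)"
      using \<zeta>_pos by (intro mult_left_mono) auto
    finally show ?case using elim(3) by (simp add: L_eq)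
  qed
qed

lemma negative_at_left_end_if_exponent_neq_1:
  assumes "exponent F \<noteq> 1" "mh \<noteq> 0 \<or> left_end F < h"
  shows "negative_at_left_end h"
  unfolding negative_at_left_end_def
proof (cases "mh = 0")
  case True
  then have "eventually (\<lambda>x. x \<in> {left_end F<..<h}) (at_right (left_end F))"
    using assms(2) by (intro eventually_at_right_real) simp
  then show "eventually (\<lambda>x. L h x < 0) (at_right (left_end F))"
    by (rule eventually_mono) (use D\<^sub>\<rho>_pos in \<open>simp add: L_mh_0[OF True] mult_pos_neg\<close>)
next
  case False
  then obtain i where i: "mh $ i \<noteq> 0" by (auto simp: vec_eq_iff)
  have "(denom i \<longlongrightarrow> D\<^sub>m $ i * 0 + \<zeta>) (at_right (left_end F))"
    unfolding denom_def[abs_def] by (intro tendsto_intros mob_tendsto_left_end[OF admissible])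
  then have "((\<lambda>x. 1 / denom i x ^ 2) \<longlongrightarrow> 1 / (D\<^sub>m $ i * 0 + \<zeta>) ^ 2) (at_right (left_end F))"
    using \<zeta>_pos by (intro tendsto_intros) auto
  from filterlim_tendsto_pos_mult_at_top[OF this _ mob_deriv_at_top[OF admissible assms(1)]]
  have "LIM x at_right (left_end F). slope i x :> at_top"
    using \<zeta>_pos by (simp add: slope_def[abs_def])
  moreover have "eventually (\<lambda>x. x \<in> regular F \<and> 0 \<le> mob_deriv F x) (at_right (left_end F))"
    using eventually_at_right_left_end[OF admissible]
    by (rule eventually_mono)
      (use mob_deriv_pos[OF admissible] in \<open>force simp: rising_def\<close>)
  ultimately show "eventually (\<lambda>x. L h x < 0) (at_right (left_end F))"
    using i eventually_L_neg by blast
qed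

lemma L_ge_if_falling:
  assumes "x \<in> regular F" "profile_deriv F x \<le> 0"
  shows "D\<^sub>\<rho> * (x - h) \<le> L h x"
proof -
  have "0 \<le> (\<Sum>j\<in>UNIV. weight j * - slope j x)"
    using mob_deriv_nonpos[OF admissible assms(2)]
    by (intro weighted_sum_nonneg) (simp add: slope_def divide_nonpos_nonneg)
  then show ?thesis
    using \<zeta>_pos by (simp add: L_eq[OF assms(1)] sum_negf mult_nonneg_nonpos)
qed

lemma L_at_input:
  assumes "h \<in> rising F"
  shows "L h h \<le> 0" and "mh \<noteq> 0 \<Longrightarrow> L h h < 0"
proof -
  have L: "L h h = - (\<zeta> / 2 * (\<Sum>j\<in>UNIV. weight j * slope j h))"
    using assms by (simp add: L_eq rising_def)
  show "L h h \<le> 0"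
    using weighted_sum_nonneg[OF less_imp_le[OF slope_pos[OF assms]]] \<zeta>_pos by (simp add: L)
  show "L h h < 0" if "mh \<noteq> 0"
    using weighted_sum_pos[OF that slope_pos[OF assms]] \<zeta>_pos by (simp add: L)
qed

lemma left_end_less_stationary:
  assumes "stationary h r" "negative_at_left_end h"
  shows "left_end F < r"
proof -
  have "eventually (\<lambda>x. x \<in> interior (bounds F) \<and> L h x < 0 \<and> left_end F < x)
      (at_right (left_end F))"
    using eventually_at_right_left_end[OF admissible] assms(2)[unfolded negative_at_left_end_def]
      eventually_at_right_less[of "left_end F"]
    by eventually_elim simp
  then obtain x where x: "x \<in> interior (bounds F)" "L h x < 0" "left_end F < x"
    using eventually_happens'[OF trivial_limit_at_right_real] by blast
  then have "x \<le> r"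
    using stationary_ge[OF assms(1), of x] interior_bounds_subset_regular[OF admissible] by auto
  then show ?thesis using x(3) by simp
qed

definition before_peak :: "real \<Rightarrow> bool" where
  "before_peak h \<longleftrightarrow> (\<forall>x. profile_deriv F x \<le> 0 \<longrightarrow> h < x)"

lemma stationary_rising:
  assumes r: "stationary h r" "negative_at_left_end h" and h: "before_peak h"
  shows "r \<in> rising F" and "r \<in> interior (bounds F)"
proof -
  have "r \<in> rising F \<and> r \<in> interior (bounds F)"
  proof (cases F)
    case (One_Sided \<xi>)
    then show ?thesis
      using left_end_less_stationary[OF r] by (simp add: rising_def regular_def)
  next
    case (Two_Sided \<alpha> \<beta> \<xi>)
    define \<mu> where "\<mu> = (\<alpha> + \<beta>) / 2"
    have \<mu>: "\<mu> \<in> interior (bounds F)" and peak: "profile_deriv F \<mu> = 0"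
      using admissible by (auto simp: Two_Sided \<mu>_def)
    then have regular: "\<mu> \<in> regular F \<inter> bounds F"
      using interior_bounds_subset_regular[OF admissible] by blast
    have "h < \<mu>" using h peak by (simp add: before_peak_def)
    then have "0 < L h \<mu>"
      using L_ge_if_falling[of \<mu> h] regular peak mult_pos_pos[OF D\<^sub>\<rho>_pos, of "\<mu> - h"] by simp
    then have "r < \<mu>"
      using stationary_le[OF r(1) regular] L_stationary[OF r(1)] \<mu> by (cases "r = \<mu>") auto
    moreover have "\<alpha> < r" using left_end_less_stationary[OF r] by (simp add: Two_Sided)
    ultimately show ?thesis
      using admissible by (auto simp: Two_Sided \<mu>_def rising_def regular_def)
  qed
  then show "r \<in> rising F" and "r \<in> interior (bounds F)" by auto
qed

definition offset :: "real \<Rightarrow> real" where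
  "offset c = c / (2 * \<zeta> * D\<^sub>\<rho>) * (\<Sum>j\<in>UNIV. weight j)"

definition threshold :: real where
  "threshold = left_end F - offset (profile_deriv F (left_end F))"

context
  assumes exponent: "exponent F = 1"
begin

lemma regular_UNIV: "regular F = UNIV"
  by (simp add: regular_def exponent)

lemma L_left_end: "L h (left_end F) = D\<^sub>\<rho> * (threshold - h)"
proof -
  have slope: "slope j (left_end F) = profile_deriv F (left_end F) / \<zeta>\<^sup>2" for j
    by (simp add: slope_def denom_def mob_left_end[OF admissible] mob_deriv_def ext_powr_deriv_def
        exponent)
  have "D\<^sub>\<rho> * offset (profile_deriv F (left_end F))
      = \<zeta> / 2 * (\<Sum>j\<in>UNIV. weight j * slope j (left_end F))"
    unfolding slope sum_distrib_right[symmetric] offset_def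
    using D\<^sub>\<rho>_pos \<zeta>_pos by (simp add: field_simps power2_eq_square)
  then show ?thesis
    by (simp add: L_eq regular_UNIV threshold_def algebra_simps)
qed

lemma negative_at_left_end_if_above_threshold:
  assumes "threshold < h"
  shows "negative_at_left_end h"
proof -
  have "isCont (L h) (left_end F)"
    using regular_bounds_subset_pole_free left_end_in_bounds[OF admissible]
    by (intro isCont_L) (auto simp: regular_UNIV)
  then have "(L h \<longlongrightarrow> L h (left_end F)) (at_right (left_end F))"
    unfolding isCont_def by (rule Lim_at_imp_Lim_at_within)
  moreover have "L h (left_end F) < 0"
    using assms D\<^sub>\<rho>_pos by (simp add: L_left_end mult_pos_neg)
  ultimately show ?thesis
    unfolding negative_at_left_end_def by (rule order_tendstoD)
qed

lemma L_left_end_nonneg: "h \<le> threshold \<Longrightarrow> 0 \<le> L h (left_end F)"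
  using D\<^sub>\<rho>_pos by (simp add: L_left_end)

lemma threshold_le_left_end: "threshold \<le> left_end F"
proof -
  have "0 \<le> offset (profile_deriv F (left_end F))"
    using profile_deriv_left_end_pos[OF admissible] D\<^sub>\<rho>_pos \<zeta>_pos
    by (simp add: offset_def sum_nonneg weight_nonneg)
  then show ?thesis by (simp add: threshold_def)
qed

lemma pole_left_of_left_end:
  assumes "mh \<noteq> 0"
  shows "\<exists>i p. mh $ i \<noteq> 0 \<and> p < left_end F \<and> denom i p = 0 \<and> {p<..left_end F} \<subseteq> pole_free"
proof -
  have "{j. mh $ j \<noteq> 0} \<noteq> {}" using assms by (auto simp: vec_eq_iff)
  then obtain i where i: "mh $ i \<noteq> 0" and i_max: "\<And>j. mh $ j \<noteq> 0 \<Longrightarrow> D\<^sub>m $ j \<le> D\<^sub>m $ i"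
    using obtains_MAX[of "{j. mh $ j \<noteq> 0}" "\<lambda>j. D\<^sub>m $ j"]
    by (metis (mono_tags, lifting) Max_ge finite finite_imageI imageI mem_Collect_eq)
  have denom: "denom j x = D\<^sub>m $ j * profile F x + \<zeta>" for j x
    by (simp add: denom_def mob_eq ext_powr_def exponent)
  obtain p where p: "p \<le> left_end F" "profile F p = - \<zeta> / D\<^sub>m $ i"
    using profile_attains_nonpos[OF admissible, of "- \<zeta> / D\<^sub>m $ i"] D\<^sub>m_pos[of i] \<zeta>_pos by auto
  have "denom i p = 0" using p(2) D\<^sub>m_pos[of i] by (simp add: denom)
  have "p \<noteq> left_end F" using p(2) D\<^sub>m_pos[of i] \<zeta>_pos by (auto simp: profile_left_end)
  then have "p < left_end F" using p(1) by simp
  have "0 < denom j x" if x: "p < x" "x \<le> left_end F" and j: "mh $ j \<noteq> 0" for j x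
  proof -
    have "profile F x \<le> 0"
      using profile_less_profile_left[OF admissible, of x "left_end F"] x(2) profile_left_end[of F]
      by (cases "x = left_end F") auto
    then have "D\<^sub>m $ i * profile F x \<le> D\<^sub>m $ j * profile F x"
      using i_max[OF j] by (simp add: mult_right_mono_neg)
    moreover have "D\<^sub>m $ i * profile F p < D\<^sub>m $ i * profile F x"
      using profile_less_profile_left[OF admissible x] D\<^sub>m_pos[of i] by simp
    ultimately show ?thesis using \<open>denom i p = 0\<close> by (simp add: denom)
  qed
  then have "{p<..left_end F} \<subseteq> pole_free" by (auto simp: pole_free_def regular_UNIV)
  then show ?thesis using i \<open>p < left_end F\<close> \<open>denom i p = 0\<close> by blast
qed

lemma mob_deriv_pos_left_of_left_end: "x \<le> left_end F \<Longrightarrow> 0 < mob_deriv F x"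
  using profile_deriv_antimono[of x "left_end F" F] profile_deriv_left_end_pos[OF admissible]
  by (simp add: mob_deriv_def ext_powr_deriv_def exponent)

lemma slope_at_top_at_pole:
  assumes "denom i p = 0" "0 < mob_deriv F p" "eventually (\<lambda>x. denom i x \<noteq> 0) (at_right p)"
  shows "LIM x at_right p. slope i x :> at_top"
proof -
  have "isCont (denom i) p" "isCont (mob_deriv F) p"
    using DERIV_denom[of p i] DERIV_mob(2)[of p F] by (auto simp: regular_UNIV DERIV_isCont)
  then have "(denom i \<longlongrightarrow> denom i p) (at_right p)"
    and mob_deriv: "(mob_deriv F \<longlongrightarrow> mob_deriv F p) (at_right p)"
    unfolding isCont_def by (auto intro: Lim_at_imp_Lim_at_within)
  from tendsto_power[OF this(1), of 2] have "((\<lambda>x. denom i x ^ 2) \<longlongrightarrow> 0) (at_right p)"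
    by (simp add: assms(1))
  moreover have "eventually (\<lambda>x. 0 < denom i x ^ 2) (at_right p)"
    using assms(3) by (rule eventually_mono) simp
  ultimately have "LIM x at_right p. inverse (denom i x ^ 2) :> at_top"
    by (rule filterlim_inverse_at_top)
  from filterlim_tendsto_pos_mult_at_top[OF mob_deriv assms(2) this] show ?thesis
    by (simp add: slope_def divide_inverse)
qed

lemma negative_left_of_left_end:
  assumes "mh \<noteq> 0"
  shows "\<exists>x < left_end F. L h x < 0 \<and> {x..left_end F} \<subseteq> pole_free"
proof -
  obtain i p where i: "mh $ i \<noteq> 0" and p: "p < left_end F" "denom i p = 0"
    and pole_free: "{p<..left_end F} \<subseteq> pole_free"
    using pole_left_of_left_end[OF assms] by blast
  have right: "eventually (\<lambda>x. x \<in> {p<..<left_end F}) (at_right p)"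
    by (rule eventually_at_right_real[OF p(1)])
  have "eventually (\<lambda>x. denom i x \<noteq> 0) (at_right p)"
    using right by (rule eventually_mono) (use pole_free i in \<open>force simp: pole_free_def\<close>)
  then have "LIM x at_right p. slope i x :> at_top"
    using p mob_deriv_pos_left_of_left_end by (intro slope_at_top_at_pole) auto
  moreover have "eventually (\<lambda>x. x \<in> regular F \<and> 0 \<le> mob_deriv F x) (at_right p)"
    using right
    by (rule eventually_mono) (auto simp: regular_UNIV mob_deriv_pos_left_of_left_end less_imp_le)
  ultimately have "eventually (\<lambda>x. L h x < 0) (at_right p)" by (rule eventually_L_neg[OF i])
  then obtain x where "L h x < 0" "x \<in> {p<..<left_end F}"
    using eventually_happens'[OF trivial_limit_at_right_real eventually_conj[OF _ right]] by blast
  moreover from this(2) have "{x..left_end F} \<subseteq> pole_free" using pole_free by auto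
  ultimately show ?thesis by auto
qed

lemma roots_nonempty_below_threshold:
  assumes "h \<le> threshold"
  shows "roots h \<noteq> {}"
proof (cases "mh = 0")
  case True
  then have "mh $ j = 0" for j by simp
  then have "h \<in> roots h" by (simp add: roots_def scalar_dom_def exponent L_mh_0[OF True])
  then show ?thesis by blast
next
  case False
  then obtain x where x: "x < left_end F" "L h x < 0" "{x..left_end F} \<subseteq> pole_free"
    using negative_left_of_left_end by blast
  have "0 \<le> L h (left_end F)" by (rule L_left_end_nonneg[OF assms])
  moreover have "isCont (L h) y" if "x \<le> y" "y \<le> left_end F" for y
    using that x(3) by (intro isCont_L) auto
  ultimately obtain y where y: "x \<le> y" "y \<le> left_end F" "L h y = 0"
    using IVT[of "L h" x 0 "left_end F"] x(1,2) by auto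
  then have "y \<in> roots h"
    using x(3) pole_free_subset_scalar_dom[OF exponent] by (auto simp: roots_def)
  then show ?thesis by blast
qed

lemma roots_below_threshold:
  assumes "h \<le> threshold"
  shows "roots h \<subseteq> {..left_end F}"
proof
  fix x assume "x \<in> roots h"
  then have root: "L h x = 0" by (simp add: roots_def)
  show "x \<in> {..left_end F}"
  proof (rule ccontr)
    assume "x \<notin> {..left_end F}"
    then have x: "left_end F < x" by simp
    have "0 < L h x"
    proof (cases "x \<in> bounds F")
      case True
      then have "L h (left_end F) < L h x"
        using strict_mono_onD[OF strict_mono_on_L _ _ x] left_end_in_bounds[OF admissible]
        by (auto simp: regular_UNIV)
      then show ?thesis using L_left_end_nonneg[OF assms] by simp
    next
      case False
      then have "profile_deriv F x \<le> 0" using x admissible by (cases F) auto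
      moreover have "0 < D\<^sub>\<rho> * (x - h)" using assms threshold_le_left_end x D\<^sub>\<rho>_pos by simp
      ultimately show ?thesis using L_ge_if_falling[of x h] by (simp add: regular_UNIV)
    qed
    then show False using root by simp
  qed
qed

lemma stationary_below_threshold:
  assumes "stationary h r" "h \<le> threshold"
  shows "r = left_end F"
proof (rule antisym)
  show "r \<le> left_end F"
    using left_end_in_bounds[OF admissible] L_left_end_nonneg[OF assms(2)]
    by (intro stationary_le[OF assms(1)]) (simp_all add: regular_UNIV)
qed (rule left_end_le[OF stationary_in_bounds[OF assms(1)]])

end

section \<open>Convergence of Newton's method\<close>

definition newton_solves :: "real \<Rightarrow> real \<Rightarrow> real \<Rightarrow> bool" where
  "newton_solves h a r \<longleftrightarrow>
     newton_converges (L h) S a r \<and> (\<lambda>n. mom (newton (L h) a n)) \<longlonglongrightarrow> mom r"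

lemma tendsto_mom:
  assumes "x \<in> regular F \<inter> bounds F" "X \<longlonglongrightarrow> x"
  shows "(\<lambda>n. mom (X n)) \<longlonglongrightarrow> mom x"
proof (rule vec_tendstoI)
  fix j
  have "(\<lambda>n. mob F (X n)) \<longlonglongrightarrow> mob F x"
    using assms by (intro isCont_tendsto_compose[OF DERIV_isCont[OF DERIV_mob(1)]]) auto
  moreover have "D\<^sub>m $ j * mob F x + \<zeta> \<noteq> 0"
    using denom_pos[of x j] assms(1) by (simp add: denom_def)
  ultimately show "(\<lambda>n. mom (X n) $ j) \<longlonglongrightarrow> mom x $ j"
    unfolding momentum_def vec_lambda_beta by (intro tendsto_intros)
qed

lemma newton_solves_rising:
  assumes r: "stationary h r" "r \<in> rising F" "r \<in> interior (bounds F)"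
    and a: "a \<in> rising F" "a \<le> r"
  shows "newton_solves h a r"
proof -
  have rising: "{a..r} \<subseteq> rising F"
    using mem_is_interval_1_I[OF is_interval_rising[OF admissible] a(1) r(2)] by auto
  then have pole_free: "{a..r} \<subseteq> pole_free" and bounds: "{a..r} \<subseteq> regular F \<inter> bounds F"
    using rising_subset_pole_free by (auto simp: rising_def)
  have antimono: "antimono_on {a..r} L_deriv"
  proof (rule monotone_onI)
    fix x y assume xy: "x \<in> {a..r}" "y \<in> {a..r}" "x \<le> y"
    show "L_deriv y \<le> L_deriv x"
    proof (rule DERIV_nonpos_imp_nonincreasing[OF xy(3)])
      fix z assume "x \<le> z" "z \<le> y"
      then have "z \<in> {a..r}" using xy by simp
      then show "\<exists>d. (L_deriv has_real_derivative d) (at z) \<and> d \<le> 0"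
        using DERIV_L_deriv L_deriv2_nonpos rising pole_free by blast
    qed
  qed
  have "newton_converges (L h) S a r"
  proof (rule newton_converges_concave_increasing[where f' = L_deriv])
    fix x assume "x \<in> {a..r}"
    then show "(L h has_real_derivative L_deriv x) (at x)" using pole_free DERIV_L by blast
    show "0 < L_deriv x" using L_deriv_ge[of x] bounds \<open>x \<in> {a..r}\<close> D\<^sub>\<rho>_pos by force
  qed (use a(2) L_stationary[OF r(1,3)] antimono bounds regular_bounds_subset_scalar_dom in auto)
  moreover from this have "newton (L h) a \<longlonglongrightarrow> r" by (simp add: newton_converges_def)
  then have "(\<lambda>n. mom (newton (L h) a n)) \<longlonglongrightarrow> mom r"
    using a(2) bounds by (intro tendsto_mom) auto
  ultimately show ?thesis by (simp add: newton_solves_def)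
qed

lemma left_of_peak:
  assumes "stationary h r" "negative_at_left_end h" "before_peak h"
  shows "roots h \<inter> bounds F = {r}"
    and "a \<in> rising F \<Longrightarrow> a \<le> r \<Longrightarrow> newton_solves h a r"
  using stationary_rising[OF assms] roots_in_bounds[OF assms(1)] newton_solves_rising[OF assms(1)]
  by auto

section \<open>One-sided mobilities\<close>

context
  fixes \<xi> :: real
  assumes F: "F = One_Sided \<xi>"
begin

lemma one_sided_rising: "rising F = {x. if \<xi> = 1 then 0 \<le> x else 0 < x}"
  by (auto simp: rising_def regular_def F)

lemma one_sided_second_deriv_neg:
  assumes "mh \<noteq> 0"
  shows "second_deriv_neg (L h) {0<..}" and "0 < c \<Longrightarrow> second_deriv_neg (L h) {c<..}"
  by (rule second_deriv_neg_L[OF assms], auto simp: one_sided_rising)+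

lemma one_sided_negative:
  assumes "stationary h r" "negative_at_left_end h"
  shows "roots h \<inter> bounds F = {r}" and "0 < r"
    and "0 < a \<or> \<xi> = 1 \<and> a = 0 \<Longrightarrow> a \<le> r \<Longrightarrow> newton_solves h a r"
proof -
  have "before_peak h" unfolding before_peak_def by (simp add: F)
  note left = left_of_peak[OF assms this]
  show "roots h \<inter> bounds F = {r}" by (rule left(1))
  show "0 < r" using left_end_less_stationary[OF assms] by (simp add: F)
  show "0 < a \<or> \<xi> = 1 \<and> a = 0 \<Longrightarrow> a \<le> r \<Longrightarrow> newton_solves h a r"
    by (rule left(2)) (auto simp: one_sided_rising)
qed

lemma one_sided_singular_negative: "\<xi> < 1 \<Longrightarrow> mh \<noteq> 0 \<or> 0 < h \<Longrightarrow> negative_at_left_end h"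
  using negative_at_left_end_if_exponent_neq_1[of h] by (simp add: F)

lemma one_sided_input_le:
  assumes "stationary h r" "0 < h"
  shows "h \<le> r" and "mh \<noteq> 0 \<Longrightarrow> h < r"
proof -
  have h: "h \<in> rising F" "h \<in> interior (bounds F)"
    using assms(2) unfolding one_sided_rising by (auto simp: F)
  then have regular: "h \<in> regular F \<inter> bounds F" by (simp add: rising_def)
  show "h \<le> r" using stationary_ge[OF assms(1) regular L_at_input(1)[OF h(1)]] .
  moreover have "h \<noteq> r" if "mh \<noteq> 0"
    using L_at_input(2)[OF h(1) that] L_stationary[OF assms(1)] h(2) by auto
  ultimately show "mh \<noteq> 0 \<Longrightarrow> h < r" by simp
qed

lemma one_sided_singular_root:
  assumes "stationary h r" "\<xi> < 1"
  shows "mh \<noteq> 0 \<or> 0 < h \<Longrightarrow> roots h \<inter> bounds F = {r}"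
    and "mh \<noteq> 0 \<or> 0 < h \<Longrightarrow> r \<in> {0<..}"
    and "mh \<noteq> 0 \<Longrightarrow> 0 < h \<Longrightarrow> r \<in> {h<..}"
  using one_sided_negative(1,2)[OF assms(1) one_sided_singular_negative[OF assms(2)]]
    one_sided_input_le(2)[OF assms(1)]
  by auto

lemma one_sided_singular_newton:
  assumes "stationary h r" "\<xi> < 1"
  shows "\<forall>\<^sub>F \<delta> in at_right 0.
    (h \<le> \<delta> \<and> (mh \<noteq> 0 \<or> 0 < h) \<longrightarrow> newton_solves h \<delta> r) \<and> (h > \<delta> \<longrightarrow> newton_solves h h r)"
proof -
  note solves = one_sided_negative(3)[OF assms(1) one_sided_singular_negative[OF assms(2)]]
  have "\<forall>\<^sub>F \<delta> in at_right 0. mh \<noteq> 0 \<or> 0 < h \<longrightarrow> newton_solves h \<delta> r"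
  proof (cases "mh \<noteq> 0 \<or> 0 < h")
    case True
    then have "0 < r"
      using one_sided_negative(2)[OF assms(1) one_sided_singular_negative[OF assms(2)]] by blast
    then show ?thesis
      using solves by (auto intro: eventually_mono[OF eventually_at_right_real])
  qed simp
  then show ?thesis
    using eventually_at_right_less[of 0]
  proof eventually_elim
    case (elim \<delta>)
    then show ?case using solves[of h] one_sided_input_le(1)[OF assms(1)] by auto
  qed
qed

end

context
  assumes F: "F = One_Sided 1"
begin

lemma one_sided_threshold: "threshold = offset (- 1)"
  unfolding threshold_def by (simp add: F offset_def)

lemma one_sided_linear_root:
  assumes "stationary h r" "offset (- 1) < h"
  shows "roots h \<inter> bounds F = {r}" and "r \<in> {0<..}" and "newton_solves h 0 r"
proof -
  have "negative_at_left_end h"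
    using assms(2) unfolding one_sided_threshold[symmetric]
    by (rule negative_at_left_end_if_above_threshold[rotated]) (simp add: F)
  note negative = one_sided_negative[OF F assms(1) this]
  show "roots h \<inter> bounds F = {r}" "r \<in> {0<..}" using negative(1,2) by auto
  then show "newton_solves h 0 r" by (intro negative(3)) auto
qed

lemma one_sided_linear_low:
  assumes "stationary h r" "h \<le> offset (- 1)"
  shows "roots h \<noteq> {}" and "roots h \<subseteq> {..0}" and "r = 0"
proof -
  have "exponent F = 1" "left_end F = 0" by (simp_all add: F)
  moreover have "h \<le> threshold" using assms(2) by (simp only: one_sided_threshold)
  ultimately show "roots h \<noteq> {}" "roots h \<subseteq> {..0}" "r = 0"
    using roots_nonempty_below_threshold roots_below_threshold
      stationary_below_threshold[OF _ assms(1)]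
    by metis+
qed

end

lemmas one_sided_table =
  one_sided_second_deriv_neg(1) one_sided_second_deriv_neg(2)[OF _ _ less_trans]
  one_sided_singular_root(1,2) one_sided_singular_root(1)[OF _ _ _ disjI1]
  one_sided_singular_root(3)[OF _ _ _ _ less_trans] one_sided_singular_newton
  one_sided_linear_low one_sided_linear_root

section \<open>Two-sided mobilities\<close>

context
  fixes \<alpha> \<beta> \<xi> :: real
  assumes F: "F = Two_Sided \<alpha> \<beta> \<xi>"
begin

lemma two_sided_rising:
  "rising F = {x. (if \<xi> = 1 then \<alpha> \<le> x else \<alpha> < x) \<and> x < (\<alpha> + \<beta>) / 2}"
  using admissible by (auto simp: rising_def regular_def F zero_less_mult_iff)

lemma reflect_in_regular: "\<alpha> + \<beta> - x \<in> regular F \<longleftrightarrow> x \<in> regular F"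
  and reflect_in_bounds: "\<alpha> + \<beta> - x \<in> bounds F \<longleftrightarrow> x \<in> bounds F"
  and reflect_in_interior: "\<alpha> + \<beta> - x \<in> interior (bounds F) \<longleftrightarrow> x \<in> interior (bounds F)"
  by (auto simp: F regular_def profile_reflect simp del: profile.simps)

lemma mob_reflect: "mob F (\<alpha> + \<beta> - x) = mob F x"
  by (simp only: mob_eq F profile_reflect)

lemma mob_deriv_reflect: "mob_deriv F (\<alpha> + \<beta> - x) = - mob_deriv F x"
  by (simp only: mob_deriv_def F profile_reflect profile_deriv_reflect mult_minus_right)

lemma reflect_in_scalar_dom: "\<alpha> + \<beta> - x \<in> S \<longleftrightarrow> x \<in> S"
  by (simp only: scalar_dom_def mem_Collect_eq reflect_in_bounds mob_reflect)

lemma mom_reflect: "mom (\<alpha> + \<beta> - x) = mom x"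
  by (simp only: momentum_def mob_reflect)

lemma slope_reflect: "slope j (\<alpha> + \<beta> - x) = - slope j x"
  by (simp add: slope_def denom_def mob_reflect mob_deriv_reflect)

lemma L_reflect:
  assumes "x \<in> regular F"
  shows "L h x = - L (\<alpha> + \<beta> - h) (\<alpha> + \<beta> - x)"
  using assms reflect_in_regular[of x]
  by (simp add: L_eq slope_reflect sum_negf) (simp add: algebra_simps)

lemma stationary_reflect:
  assumes "stationary h r"
  shows "stationary (\<alpha> + \<beta> - h) (\<alpha> + \<beta> - r)"
  unfolding stationary_def
proof (rule changes_sign_at_reflect[OF assms[unfolded stationary_def] reflect_in_bounds
      reflect_in_interior])
  fix x assume "x \<in> interior (bounds F)"
  then show "L (\<alpha> + \<beta> - h) x = - L h (\<alpha> + \<beta> - x)"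
    using L_reflect[of x "\<alpha> + \<beta> - h"] interior_bounds_subset_regular[OF admissible] by auto
qed

lemma reflect_in_roots: "\<alpha> + \<beta> - x \<in> roots (\<alpha> + \<beta> - h) \<longleftrightarrow> x \<in> roots h"
  using L_reflect[of x h] reflect_in_scalar_dom[of x] scalar_dom_subset_regular
  by (auto simp: roots_def)

lemma newton_solves_reflect:
  assumes "newton_solves (\<alpha> + \<beta> - h) (\<alpha> + \<beta> - a) (\<alpha> + \<beta> - r)"
  shows "newton_solves h a r"
proof -
  have converges: "newton_converges (L (\<alpha> + \<beta> - h)) S (\<alpha> + \<beta> - a) (\<alpha> + \<beta> - r)"
    and mom: "(\<lambda>n. mom (newton (L (\<alpha> + \<beta> - h)) (\<alpha> + \<beta> - a) n)) \<longlonglongrightarrow> mom r"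
    using assms by (auto simp: newton_solves_def mom_reflect)
  have dom: "\<alpha> + \<beta> - x \<in> S \<inter> regular F" if "x \<in> S" for x
    using that scalar_dom_subset_regular by (auto simp: reflect_in_scalar_dom reflect_in_regular)
  have "newton_converges (L h) S a r"
    using newton_converges_reflect[OF converges open_regular dom L_reflect] by simp
  moreover have "newton (L h) a = (\<lambda>n. \<alpha> + \<beta> - newton (L (\<alpha> + \<beta> - h)) (\<alpha> + \<beta> - a) n)"
    using newton_reflect[OF converges open_regular dom L_reflect] by simp
  ultimately show ?thesis
    using mom by (simp add: newton_solves_def mom_reflect)
qed

lemma two_sided_left:
  assumes "stationary h r" "negative_at_left_end h" "h < (\<alpha> + \<beta>) / 2"
  shows "roots h \<inter> bounds F = {r}" and "r \<in> {\<alpha><..<(\<alpha> + \<beta>) / 2}"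
    and "\<alpha> < a \<or> \<xi> = 1 \<and> a = \<alpha> \<Longrightarrow> a \<le> r \<Longrightarrow> newton_solves h a r"
proof -
  have "before_peak h" using assms(3) unfolding before_peak_def by (auto simp: F)
  note left = left_of_peak[OF assms(1,2) this]
  show "roots h \<inter> bounds F = {r}" by (rule left(1))
  show r: "r \<in> {\<alpha><..<(\<alpha> + \<beta>) / 2}"
    using stationary_rising[OF assms(1,2) \<open>before_peak h\<close>] left_end_less_stationary[OF assms(1,2)]
    by (simp add: two_sided_rising) (simp add: F)
  show "\<alpha> < a \<or> \<xi> = 1 \<and> a = \<alpha> \<Longrightarrow> a \<le> r \<Longrightarrow> newton_solves h a r"
    using r by (intro left(2)) (auto simp: two_sided_rising)
qed

lemma two_sided_right:
  assumes "stationary h r" "negative_at_left_end (\<alpha> + \<beta> - h)" "h > (\<alpha> + \<beta>) / 2"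
  shows "roots h \<inter> bounds F = {r}" and "r \<in> {(\<alpha> + \<beta>) / 2<..<\<beta>}"
    and "a < \<beta> \<or> \<xi> = 1 \<and> a = \<beta> \<Longrightarrow> r \<le> a \<Longrightarrow> newton_solves h a r"
proof -
  have "\<alpha> + \<beta> - h < (\<alpha> + \<beta>) / 2" using assms(3) by (simp add: field_simps)
  note left = two_sided_left[OF stationary_reflect[OF assms(1)] assms(2) this]
  show "r \<in> {(\<alpha> + \<beta>) / 2<..<\<beta>}" using left(2) by (auto simp: field_simps)
  then show "roots h \<inter> bounds F = {r}"
    using roots_in_bounds[OF assms(1)] admissible by (auto simp: F)
  show "a < \<beta> \<or> \<xi> = 1 \<and> a = \<beta> \<Longrightarrow> r \<le> a \<Longrightarrow> newton_solves h a r"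
    by (rule newton_solves_reflect[OF left(3)]) auto
qed

lemma two_sided_middle:
  assumes "stationary h r" "h = (\<alpha> + \<beta>) / 2"
  shows "roots h \<inter> bounds F = {(\<alpha> + \<beta>) / 2}" and "r = (\<alpha> + \<beta>) / 2"
proof -
  have h: "h \<in> interior (bounds F)" using admissible assms(2) by (simp add: F)
  then have regular: "h \<in> regular F \<inter> bounds F"
    using interior_bounds_subset_regular[OF admissible] by blast
  have "\<alpha> + \<beta> - h = h" using assms(2) by (simp add: field_simps)
  then have "L h h = 0" using L_reflect[of h h] regular by simp
  then have "r = h" by (rule stationary_root[OF assms(1) regular])
  moreover from this have "roots h \<inter> bounds F = {h}" using roots_in_bounds[OF assms(1)] h by simp
  ultimately show "roots h \<inter> bounds F = {(\<alpha> + \<beta>) / 2}" "r = (\<alpha> + \<beta>) / 2"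
    unfolding assms(2)[symmetric] by simp_all
qed

lemma two_sided_second_deriv_neg: "mh \<noteq> 0 \<Longrightarrow> second_deriv_neg (L h) {\<alpha><..<(\<alpha> + \<beta>) / 2}"
  by (rule second_deriv_neg_L) (auto simp: two_sided_rising)

lemma two_sided_second_deriv_pos:
  assumes "mh \<noteq> 0"
  shows "second_deriv_pos (L h) {(\<alpha> + \<beta>) / 2<..<\<beta>}"
proof (rule second_deriv_pos_reflect[OF two_sided_second_deriv_neg[OF assms]])
  show "L h x = - L (\<alpha> + \<beta> - h) (\<alpha> + \<beta> - x)" if "x \<in> {(\<alpha> + \<beta>) / 2<..<\<beta>}" for x
    using that admissible by (intro L_reflect) (auto simp: F regular_def)
qed (auto simp: field_simps)

lemma two_sided_singular_negative: "\<xi> < 1 \<Longrightarrow> mh \<noteq> 0 \<or> \<alpha> < h \<Longrightarrow> negative_at_left_end h"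
  using negative_at_left_end_if_exponent_neq_1[of h] by (simp add: F)

lemma two_sided_singular_left:
  assumes "stationary h r" "\<xi> < 1" "h < (\<alpha> + \<beta>) / 2" "mh \<noteq> 0 \<or> \<alpha> < h"
  shows "roots h \<inter> bounds F = {r}" and "r \<in> {\<alpha><..<(\<alpha> + \<beta>) / 2}"
    and "\<forall>\<^sub>F \<delta> in at_right 0. newton_solves h (\<alpha> + \<delta>) r"
proof -
  note left = two_sided_left[OF assms(1) two_sided_singular_negative[OF assms(2,4)] assms(3)]
  show "roots h \<inter> bounds F = {r}" "r \<in> {\<alpha><..<(\<alpha> + \<beta>) / 2}" by (rule left)+
  then have "\<forall>\<^sub>F \<delta> in at_right 0. \<delta> \<in> {0<..<r - \<alpha>}" by (intro eventually_at_right_real) simp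
  then show "\<forall>\<^sub>F \<delta> in at_right 0. newton_solves h (\<alpha> + \<delta>) r"
    by (rule eventually_mono) (auto intro!: left(3))
qed

lemma two_sided_singular_right:
  assumes "stationary h r" "\<xi> < 1" "h > (\<alpha> + \<beta>) / 2" "mh \<noteq> 0 \<or> h < \<beta>"
  shows "roots h \<inter> bounds F = {r}" and "r \<in> {(\<alpha> + \<beta>) / 2<..<\<beta>}"
    and "\<forall>\<^sub>F \<delta> in at_right 0. newton_solves h (\<beta> - \<delta>) r"
proof -
  have "negative_at_left_end (\<alpha> + \<beta> - h)"
    using two_sided_singular_negative[OF assms(2)] assms(4) by simp
  note right = two_sided_right[OF assms(1) this assms(3)]
  show "roots h \<inter> bounds F = {r}" "r \<in> {(\<alpha> + \<beta>) / 2<..<\<beta>}" by (rule right)+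
  then have "\<forall>\<^sub>F \<delta> in at_right 0. \<delta> \<in> {0<..<\<beta> - r}" by (intro eventually_at_right_real) simp
  then show "\<forall>\<^sub>F \<delta> in at_right 0. newton_solves h (\<beta> - \<delta>) r"
    by (rule eventually_mono) (auto intro!: right(3))
qed

lemma two_sided_singular_newton:
  assumes "stationary h r" "\<xi> < 1"
  shows "\<forall>\<^sub>F \<delta> in at_right 0.
    (h < (\<alpha> + \<beta>) / 2 \<and> (mh \<noteq> 0 \<or> \<alpha> < h) \<longrightarrow> newton_solves h (\<alpha> + \<delta>) r) \<and>
    (h > (\<alpha> + \<beta>) / 2 \<and> (mh \<noteq> 0 \<or> h < \<beta>) \<longrightarrow> newton_solves h (\<beta> - \<delta>) r)"
proof (rule eventually_conj)
  show "\<forall>\<^sub>F \<delta> in at_right 0.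
      h < (\<alpha> + \<beta>) / 2 \<and> (mh \<noteq> 0 \<or> \<alpha> < h) \<longrightarrow> newton_solves h (\<alpha> + \<delta>) r"
    using two_sided_singular_left(3)[OF assms]
    by (cases "h < (\<alpha> + \<beta>) / 2 \<and> (mh \<noteq> 0 \<or> \<alpha> < h)") auto
  show "\<forall>\<^sub>F \<delta> in at_right 0.
      h > (\<alpha> + \<beta>) / 2 \<and> (mh \<noteq> 0 \<or> h < \<beta>) \<longrightarrow> newton_solves h (\<beta> - \<delta>) r"
    using two_sided_singular_right(3)[OF assms]
    by (cases "h > (\<alpha> + \<beta>) / 2 \<and> (mh \<noteq> 0 \<or> h < \<beta>)") auto
qed

end

context
  fixes \<alpha> \<beta> :: real
  assumes F: "F = Two_Sided \<alpha> \<beta> 1"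
begin

lemma two_sided_threshold: "threshold = \<alpha> - offset (\<beta> - \<alpha>)"
  unfolding threshold_def by (simp add: F)

lemma two_sided_quadratic_negative: "\<alpha> - offset (\<beta> - \<alpha>) < h \<Longrightarrow> negative_at_left_end h"
  unfolding two_sided_threshold[symmetric]
  by (rule negative_at_left_end_if_above_threshold) (simp add: F)

lemma two_sided_quadratic_left:
  assumes "stationary h r" "\<alpha> - offset (\<beta> - \<alpha>) < h" "h < (\<alpha> + \<beta>) / 2"
  shows "roots h \<inter> bounds F = {r}" and "r \<in> {\<alpha><..<(\<alpha> + \<beta>) / 2}" and "newton_solves h \<alpha> r"
proof -
  note left = two_sided_left[OF F assms(1) two_sided_quadratic_negative[OF assms(2)] assms(3)]
  show "roots h \<inter> bounds F = {r}" "r \<in> {\<alpha><..<(\<alpha> + \<beta>) / 2}" by (rule left)+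
  then show "newton_solves h \<alpha> r" by (intro left(3)) auto
qed

lemma two_sided_quadratic_right:
  assumes "stationary h r" "h > (\<alpha> + \<beta>) / 2" "h < \<beta> + offset (\<beta> - \<alpha>)"
  shows "roots h \<inter> bounds F = {r}" and "r \<in> {(\<alpha> + \<beta>) / 2<..<\<beta>}" and "newton_solves h \<beta> r"
proof -
  have "negative_at_left_end (\<alpha> + \<beta> - h)"
    using assms(3) by (intro two_sided_quadratic_negative) simp
  note right = two_sided_right[OF F assms(1) this assms(2)]
  show "roots h \<inter> bounds F = {r}" "r \<in> {(\<alpha> + \<beta>) / 2<..<\<beta>}" by (rule right)+
  then show "newton_solves h \<beta> r" by (intro right(3)) auto
qed

lemma two_sided_quadratic_low:
  assumes "stationary h r" "h \<le> \<alpha> - offset (\<beta> - \<alpha>)"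
  shows "roots h \<noteq> {}" and "roots h \<subseteq> {..\<alpha>}" and "r = \<alpha>"
proof -
  have "exponent F = 1" "left_end F = \<alpha>" by (simp_all add: F)
  moreover have "h \<le> threshold" using assms(2) by (simp only: two_sided_threshold)
  ultimately show "roots h \<noteq> {}" "roots h \<subseteq> {..\<alpha>}" "r = \<alpha>"
    using roots_nonempty_below_threshold roots_below_threshold
      stationary_below_threshold[OF _ assms(1)]
    by metis+
qed

lemma two_sided_quadratic_high:
  assumes "stationary h r" "h \<ge> \<beta> + offset (\<beta> - \<alpha>)"
  shows "roots h \<noteq> {}" and "roots h \<subseteq> {\<beta>..}" and "r = \<beta>"
proof -
  have "\<alpha> + \<beta> - h \<le> \<alpha> - offset (\<beta> - \<alpha>)" using assms(2) by simp
  note low = two_sided_quadratic_low[OF stationary_reflect[OF F assms(1)] this]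
  obtain x where "x \<in> roots (\<alpha> + \<beta> - h)" using low(1) by blast
  then have "\<alpha> + \<beta> - x \<in> roots h" using reflect_in_roots[OF F, of "\<alpha> + \<beta> - x" h] by simp
  then show "roots h \<noteq> {}" by blast
  show "roots h \<subseteq> {\<beta>..}" using low(2) reflect_in_roots[OF F] by fastforce
  show "r = \<beta>" using low(3) by simp
qed

end

lemmas two_sided_table =
  two_sided_second_deriv_neg two_sided_second_deriv_pos two_sided_middle
  two_sided_singular_left two_sided_singular_right two_sided_singular_newton
  two_sided_quadratic_left two_sided_quadratic_right two_sided_quadratic_low
  two_sided_quadratic_high

end

theorem theorem4p1:
  fixes F :: mobility
    and D\<^sub>\<rho> \<zeta> \<rho>h C\<^sub>1 :: real
    and D\<^sub>m mh :: "real ^ 'd"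
    and L :: "real \<Rightarrow> real"
    and S R :: "real set"
    and mom :: "real \<Rightarrow> real ^ 'd"
    and C\<^sub>2 \<rho>\<^sub>m :: "real \<Rightarrow> real \<Rightarrow> real"
    and sol :: "real \<times> (real ^ 'd) \<Rightarrow> bool"
    and conv :: "real \<Rightarrow> real \<Rightarrow> real ^ 'd \<Rightarrow> bool"
  assumes "D\<^sub>\<rho> > 0" and "\<And>j. D\<^sub>m $ j > 0" and "\<zeta> > 0"
    and "admissible F"
    and sol_def: "sol = is_arg_min (objective F D\<^sub>\<rho> D\<^sub>m \<zeta> \<rho>h mh) (\<lambda>_. True)"
    and L_def: "L = scalar_fun F D\<^sub>\<rho> D\<^sub>m \<zeta> \<rho>h mh"
    and S_def: "S = scalar_dom F D\<^sub>m \<zeta> mh"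
    and R_def: "R = {\<rho> \<in> S. L \<rho> = 0}"
    and mom_def: "mom = momentum F D\<^sub>m \<zeta> mh"
    and conv_def: "conv = (\<lambda>\<rho>0 \<rho>s ms. newton_converges L S \<rho>0 \<rho>s
                              \<and> (\<lambda>n. mom (newton L \<rho>0 n)) \<longlonglongrightarrow> ms)"
    and C1_def: "C\<^sub>1 = - 1 / (2 * \<zeta> * D\<^sub>\<rho>) * (\<Sum>j\<in>UNIV. (D\<^sub>m $ j * mh $ j)\<^sup>2)"
    and C2_def: "C\<^sub>2 = (\<lambda>\<alpha> \<beta>. (\<beta> - \<alpha>) / (2 * \<zeta> * D\<^sub>\<rho>) * (\<Sum>j\<in>UNIV. (D\<^sub>m $ j * mh $ j)\<^sup>2))"
    and \<rho>m_def: "\<rho>\<^sub>m = (\<lambda>\<alpha> \<beta>. (\<alpha> + \<beta>) / 2)"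
  shows
    \<comment> \<open>(A)\<close>
    "(\<exists>!p. sol p) \<and>
     (\<forall>\<rho>s ms. sol (\<rho>s, ms) \<longrightarrow>
        \<rho>s \<in> bounds F \<and> mob F \<rho>s \<ge> 0 \<and>
        (\<forall>\<rho> \<in> R \<inter> bounds F. \<rho>s = \<rho>) \<and> (R \<inter> bounds F = {} \<longrightarrow> mob F \<rho>s = 0) \<and>
        ms = mom \<rho>s \<and>
     \<comment> \<open>(B)\<close>
     (\<forall>\<xi> \<delta>. F = One_Sided \<xi> \<and> \<xi> < 1 \<and> \<delta> > 0 \<longrightarrow>
        (\<rho>h \<le> \<delta> \<longrightarrow>
           (mh \<noteq> 0 \<or> 0 < \<rho>h \<longrightarrow> R \<inter> bounds F = {\<rho>s} \<and> \<rho>s \<in> {0<..}) \<and>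
           (mh \<noteq> 0 \<longrightarrow> second_deriv_neg L {0<..})) \<and>
        (\<rho>h > \<delta> \<longrightarrow>
           (mh \<noteq> 0 \<longrightarrow> R \<inter> bounds F = {\<rho>s} \<and> \<rho>s \<in> {\<rho>h<..}) \<and>
           (mh \<noteq> 0 \<longrightarrow> second_deriv_neg L {\<rho>h<..}))) \<and>
     (F = One_Sided 1 \<longrightarrow>
        (\<rho>h \<le> C\<^sub>1 \<longrightarrow> R \<noteq> {} \<and> R \<subseteq> {..0} \<and> \<rho>s = 0) \<and>
        (\<rho>h > C\<^sub>1 \<longrightarrow>
           R \<inter> bounds F = {\<rho>s} \<and> \<rho>s \<in> {0<..} \<and>
           (mh \<noteq> 0 \<longrightarrow> second_deriv_neg L {0<..}))) \<and>
     (\<forall>\<alpha> \<beta> \<xi>. F = Two_Sided \<alpha> \<beta> \<xi> \<and> \<xi> < 1 \<longrightarrow>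
        (\<rho>h < \<rho>\<^sub>m \<alpha> \<beta> \<longrightarrow>
           (mh \<noteq> 0 \<or> \<alpha> < \<rho>h \<longrightarrow> R \<inter> bounds F = {\<rho>s} \<and> \<rho>s \<in> {\<alpha><..<\<rho>\<^sub>m \<alpha> \<beta>}) \<and>
           (mh \<noteq> 0 \<longrightarrow> second_deriv_neg L {\<alpha><..<\<rho>\<^sub>m \<alpha> \<beta>})) \<and>
        (\<rho>h = \<rho>\<^sub>m \<alpha> \<beta> \<longrightarrow> R \<inter> bounds F = {\<rho>\<^sub>m \<alpha> \<beta>} \<and> \<rho>s = \<rho>\<^sub>m \<alpha> \<beta>) \<and>
        (\<rho>h > \<rho>\<^sub>m \<alpha> \<beta> \<longrightarrow>
           (mh \<noteq> 0 \<or> \<rho>h < \<beta> \<longrightarrow> R \<inter> bounds F = {\<rho>s} \<and> \<rho>s \<in> {\<rho>\<^sub>m \<alpha> \<beta><..<\<beta>}) \<and>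
           (mh \<noteq> 0 \<longrightarrow> second_deriv_pos L {\<rho>\<^sub>m \<alpha> \<beta><..<\<beta>}))) \<and>
     (\<forall>\<alpha> \<beta>. F = Two_Sided \<alpha> \<beta> 1 \<longrightarrow>
        (\<rho>h \<le> \<alpha> - C\<^sub>2 \<alpha> \<beta> \<longrightarrow> R \<noteq> {} \<and> R \<subseteq> {..\<alpha>} \<and> \<rho>s = \<alpha>) \<and>
        (\<alpha> - C\<^sub>2 \<alpha> \<beta> < \<rho>h \<and> \<rho>h < \<rho>\<^sub>m \<alpha> \<beta> \<longrightarrow>
           R \<inter> bounds F = {\<rho>s} \<and> \<rho>s \<in> {\<alpha><..<\<rho>\<^sub>m \<alpha> \<beta>} \<and>
           (mh \<noteq> 0 \<longrightarrow> second_deriv_neg L {\<alpha><..<\<rho>\<^sub>m \<alpha> \<beta>})) \<and>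
        (\<rho>h = \<rho>\<^sub>m \<alpha> \<beta> \<longrightarrow> R \<inter> bounds F = {\<rho>\<^sub>m \<alpha> \<beta>} \<and> \<rho>s = \<rho>\<^sub>m \<alpha> \<beta>) \<and>
        (\<rho>\<^sub>m \<alpha> \<beta> < \<rho>h \<and> \<rho>h < \<beta> + C\<^sub>2 \<alpha> \<beta> \<longrightarrow>
           R \<inter> bounds F = {\<rho>s} \<and> \<rho>s \<in> {\<rho>\<^sub>m \<alpha> \<beta><..<\<beta>} \<and>
           (mh \<noteq> 0 \<longrightarrow> second_deriv_pos L {\<rho>\<^sub>m \<alpha> \<beta><..<\<beta>})) \<and>
        (\<rho>h \<ge> \<beta> + C\<^sub>2 \<alpha> \<beta> \<longrightarrow> R \<noteq> {} \<and> R \<subseteq> {\<beta>..} \<and> \<rho>s = \<beta>)) \<and>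
     \<comment> \<open>(C)\<close>
     (\<forall>\<xi>. F = One_Sided \<xi> \<and> \<xi> < 1 \<longrightarrow>
        (\<forall>\<^sub>F \<delta> in at_right 0.
           (\<rho>h \<le> \<delta> \<and> (mh \<noteq> 0 \<or> 0 < \<rho>h) \<longrightarrow> conv \<delta> \<rho>s ms) \<and>
           (\<rho>h > \<delta> \<longrightarrow> conv \<rho>h \<rho>s ms))) \<and>
     (F = One_Sided 1 \<and> \<rho>h > C\<^sub>1 \<longrightarrow> conv 0 \<rho>s ms) \<and>
     (\<forall>\<alpha> \<beta> \<xi>. F = Two_Sided \<alpha> \<beta> \<xi> \<and> \<xi> < 1 \<longrightarrow>
        (\<forall>\<^sub>F \<delta> in at_right 0.
           (\<rho>h < \<rho>\<^sub>m \<alpha> \<beta> \<and> (mh \<noteq> 0 \<or> \<alpha> < \<rho>h) \<longrightarrow> conv (\<alpha> + \<delta>) \<rho>s ms) \<and>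
           (\<rho>h > \<rho>\<^sub>m \<alpha> \<beta> \<and> (mh \<noteq> 0 \<or> \<rho>h < \<beta>) \<longrightarrow> conv (\<beta> - \<delta>) \<rho>s ms))) \<and>
     (\<forall>\<alpha> \<beta>. F = Two_Sided \<alpha> \<beta> 1 \<longrightarrow>
        (\<alpha> - C\<^sub>2 \<alpha> \<beta> < \<rho>h \<and> \<rho>h < \<rho>\<^sub>m \<alpha> \<beta> \<longrightarrow> conv \<alpha> \<rho>s ms) \<and>
        (\<rho>\<^sub>m \<alpha> \<beta> < \<rho>h \<and> \<rho>h < \<beta> + C\<^sub>2 \<alpha> \<beta> \<longrightarrow> conv \<beta> \<rho>s ms)))"
proof -
  interpret mobility_problem F D\<^sub>\<rho> \<zeta> D\<^sub>m mh
    using assms(1-4) by unfold_locales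
  obtain r where r: "stationary \<rho>h r" using stationary_exists by blast
  note bounds = stationary_in_bounds[OF r]
  have sol: "sol p \<longleftrightarrow> p = (r, mom r)" for p
    unfolding sol_def mom_def by (rule is_arg_min_iff[OF r])
  have R: "R = roots \<rho>h" by (simp add: R_def S_def L_def roots_def)
  have conv: "conv a r (mom r) \<longleftrightarrow> newton_solves \<rho>h a r" for a
    by (simp add: conv_def newton_solves_def S_def L_def mom_def)
  have C: "C\<^sub>1 = offset (- 1)" "C\<^sub>2 = (\<lambda>\<alpha> \<beta>. offset (\<beta> - \<alpha>))"
    by (simp_all add: C1_def C2_def offset_def weight_def)
  let "_ \<and> (\<forall>\<rho>s ms. _ \<rho>s ms \<longrightarrow> ?properties \<rho>s ms)" = ?thesis
  have "?properties \<rho>s ms" if "sol (\<rho>s, ms)" for \<rho>s ms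
  proof -
    have eq: "\<rho>s = r" "ms = mom r" using that by (simp_all add: sol)
    show ?thesis
      using r unfolding eq R conv C L_def \<rho>m_def
    proof (intro conjI allI impI ballI refl bounds mob_nonneg[OF bounds]; (elim conjE)?)
    qed (rule root_in_bounds_eq mob_eq_0_if_no_root one_sided_table two_sided_table; assumption)+
  qed
  moreover have "\<exists>!p. sol p" by (simp add: sol)
  ultimately show ?thesis by blast
qed

end
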